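(* Let $d$ be a positive integer and let $a_0,\ldots,a_{d-1}$ be integers. Set $N=\min\{a_0,\ldots,a_{d-1}\}$. Then the following hold: (1) If $N \geq -2$, then for any integer $n \geq 5d+3$, the polynomial $nx^d+a_{d-1}x^{d-1}+\cdots+a_0$ is a Hilbert polynomial. (2) If $N < -2$, then for any integer $n \geq -10d\lfloor N/5 \rfloor+3$, the polynomial $nx^d+a_{d-1}x^{d-1}+\cdots+a_0$ is a Hilbert polynomial.
   Context: Let $k$ be a field. Let $R=\bigoplus_{i\ge 0}R_i$ be a finitely generated graded commutative $k$-algebra. Its Hilbert function is $H(R;i):=\dim_k(R_i)$, where $R_i$ is the graded component of $R$ of degree $i$. The algebra $R$ is called standard if it can be finitely generated as a $k$-algebra by elements of $R_1$. If $R$ is standard, there is a (unique) polynomial $P_R(x)\in\mathbb{Q}[x]$ such that $H(R;i)=P_R(i)$ for all sufficiently large integers $i$; $P_R(x)$ is called the Hilbert polynomial of $R$. A polynomial $f(x)\in\mathbb{Q}[x]$ is called a Hilbert polynomial if $f(x)=P_R(x)$ for some standard graded commutative $k$-algebra $R$. *)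

theory Defs
  imports
    "Jordan_Normal_Form.Missing_VectorSpace"
    "HOL-Algebra.Generated_Rings"
    "HOL-Computational_Algebra.Polynomial"
    "HOL-Library.Countable_Set"
begin

section \<open>Graded algebras and Hilbert polynomials\<close>

text \<open>
  The grading is an internal direct sum decomposition of the commutative algebra \<open>R\<close> over the
  field \<open>K\<close>. In an \<open>\<nat>\<close>-graded ring the unit automatically has degree \<open>0\<close>, so this is not assumed.
\<close>

locale graded_algebra = algebra K R + field K
  for K :: "('a, 'm) ring_scheme" (structure) and R :: "('a, 'c, 'n) module_scheme" (structure) +
  fixes G :: "nat \<Rightarrow> 'c set"
  assumes component_subspace: "VectorSpace.subspace K (G i) R"
    and component_mult: "\<lbrakk>x \<in> G i; y \<in> G j\<rbrakk> \<Longrightarrow> x \<otimes>\<^bsub>R\<^esub> y \<in> G (i + j)"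
    and direct_sum: "x \<in> carrier R \<Longrightarrow>
      \<exists>!f. (\<forall>i. f i \<in> G i) \<and> finite {i. f i \<noteq> \<zero>\<^bsub>R\<^esub>} \<and>
           x = (\<Oplus>\<^bsub>R\<^esub>i\<in>{i. f i \<noteq> \<zero>\<^bsub>R\<^esub>}. f i)"
begin

text \<open>
  \<^const>\<open>vectorspace.dim\<close> is only meaningful for finite-dimensional spaces. All components of a
  standard graded algebra (below) are finite-dimensional: the component of degree \<open>i\<close> is spanned
  by the products of \<open>i\<close> of the finitely many generators.
\<close>

definition hilbert_function :: "nat \<Rightarrow> nat" where
  "hilbert_function i = vectorspace.dim K (R\<lparr>carrier := G i\<rparr>)"

definition has_hilbert_polynomial :: "rat poly \<Rightarrow> bool" where
  "has_hilbert_polynomial P \<longleftrightarrow>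
     (\<forall>\<^sub>F i in sequentially. of_nat (hilbert_function i) = poly P (of_nat i))"

lemma has_hilbert_polynomial_unique:
  assumes "has_hilbert_polynomial P" and "has_hilbert_polynomial Q"
  shows "P = Q"
proof -
  have "\<forall>\<^sub>F i in sequentially. poly (P - Q) (of_nat i) = 0"
    using assms unfolding has_hilbert_polynomial_def by eventually_elim simp
  then obtain n where "\<And>i. i \<ge> n \<Longrightarrow> poly (P - Q) (of_nat i) = 0"
    by (auto simp: eventually_sequentially)
  then have "of_nat ` {n..} \<subseteq> {x. poly (P - Q) x = 0}" by auto
  moreover have "infinite (of_nat ` {n..} :: rat set)"
    by (simp add: finite_image_iff infinite_Ici inj_on_def)
  ultimately show ?thesis
    using poly_roots_finite[of "P - Q"] finite_subset by fastforce
qed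

end

text \<open>
  The \<open>K\<close>-subalgebra generated by \<open>S\<close> is the subring generated by \<open>S\<close> and the scalars \<open>c \<cdot> 1\<close>.
\<close>

locale standard_graded_algebra = graded_algebra K R G
  for K :: "('a, 'm) ring_scheme" (structure) and R :: "('a, 'c, 'n) module_scheme" (structure) and G +
  assumes generated_in_degree_one:
    "\<exists>S\<subseteq>G 1. finite S \<and>
       generate_ring R ((\<lambda>c. c \<odot>\<^bsub>R\<^esub> \<one>\<^bsub>R\<^esub>) ` carrier K \<union> S) = carrier R"

text \<open>
  An existential quantifier cannot range over types, so the carrier of \<open>R\<close> is taken inside the type
  \<open>nat \<Rightarrow> 'a\<close>. This loses nothing: every standard graded algebra over \<open>K\<close>, with carrier in any type,
  is isomorphic to one of this form, see \<open>is_hilbert_polynomialI\<close> at the end.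
\<close>

definition is_hilbert_polynomial :: "('a, 'm) ring_scheme \<Rightarrow> rat poly \<Rightarrow> bool" where
  "is_hilbert_polynomial K f \<longleftrightarrow>
     (\<exists>(R :: ('a, nat \<Rightarrow> 'a) module) G.
        standard_graded_algebra K R G \<and> graded_algebra.has_hilbert_polynomial K R G f)"


section \<open>Independence of the carrier type\<close>

text \<open>
  Every element of a finitely generated algebra is the value of a term in the generators and finitely
  many scalars. A term is split into its shape and an assignment of scalars to the occurrences of
  constants, the assignment of a binary node interleaving those of its two subterms.
\<close>

datatype shape = Shape_One | Shape_Gen nat | Shape_Const | Shape_Neg shape | Shape_Add shape shape | Shape_Mul shape shape

instance shape :: countable
  by countable_datatype

fun shape_eval :: "('a, 'b, 'x) module_scheme \<Rightarrow> (nat \<Rightarrow> 'b) \<Rightarrow> shape \<Rightarrow> (nat \<Rightarrow> 'a) \<Rightarrow> 'b" where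
  "shape_eval R g Shape_One c = \<one>\<^bsub>R\<^esub>"
| "shape_eval R g (Shape_Gen n) c = g n"
| "shape_eval R g Shape_Const c = c 0 \<odot>\<^bsub>R\<^esub> \<one>\<^bsub>R\<^esub>"
| "shape_eval R g (Shape_Neg s) c = \<ominus>\<^bsub>R\<^esub> shape_eval R g s c"
| "shape_eval R g (Shape_Add s t) c =
     shape_eval R g s (\<lambda>n. c (2 * n)) \<oplus>\<^bsub>R\<^esub> shape_eval R g t (\<lambda>n. c (2 * n + 1))"
| "shape_eval R g (Shape_Mul s t) c =
     shape_eval R g s (\<lambda>n. c (2 * n)) \<otimes>\<^bsub>R\<^esub> shape_eval R g t (\<lambda>n. c (2 * n + 1))"

lemma interleave:
  fixes c d :: "nat \<Rightarrow> 'a"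
  obtains e where "(\<lambda>n. e (2 * n)) = c" "(\<lambda>n. e (2 * n + 1)) = d"
proof
  let ?e = "\<lambda>n. if even n then c (n div 2) else d (n div 2)"
  show "(\<lambda>n. ?e (2 * n)) = c" "(\<lambda>n. ?e (2 * n + 1)) = d" by auto
qed

lemma generate_ring_shape:
  assumes "x \<in> generate_ring R ((\<lambda>c. c \<odot>\<^bsub>R\<^esub> \<one>\<^bsub>R\<^esub>) ` C \<union> S)" and S: "S \<subseteq> range g"
  shows "\<exists>s c. shape_eval R g s c = x"
  using assms(1)
proof induction
  case one
  then show ?case by (metis shape_eval.simps(1))
next
  case (incl h)
  show ?case
  proof (cases "h \<in> S")
    case True
    then obtain n where "h = g n" using S by blast
    then show ?thesis by (metis shape_eval.simps(2))
  next
    case False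
    then obtain a where "h = a \<odot>\<^bsub>R\<^esub> \<one>\<^bsub>R\<^esub>" using incl by blast
    then have "shape_eval R g Shape_Const (\<lambda>_. a) = h" by simp
    then show ?thesis by blast
  qed
next
  case (a_inv h)
  then show ?case by (metis shape_eval.simps(4))
next
  case (eng_add x y)
  then obtain s c t d where "shape_eval R g s c = x" "shape_eval R g t d = y" by blast
  then show ?case using interleave[of c d] by (metis shape_eval.simps(5))
next
  case (eng_mult x y)
  then obtain s c t d where "shape_eval R g s c = x" "shape_eval R g t d = y" by blast
  then show ?case using interleave[of c d] by (metis shape_eval.simps(6))
qed

lemma (in standard_graded_algebra) embeds_in_sequences:
  "\<exists>h :: 'c \<Rightarrow> nat \<Rightarrow> 'a. inj_on h (carrier R)"
proof -
  obtain S where S: "finite S"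
    and gen: "generate_ring R ((\<lambda>c. c \<odot>\<^bsub>R\<^esub> \<one>\<^bsub>R\<^esub>) ` carrier K \<union> S) = carrier R"
    using generated_in_degree_one by blast
  define g where "g = from_nat_into (insert \<one>\<^bsub>R\<^esub> S)"
  have g: "S \<subseteq> range g"
    unfolding g_def using S
    by (subst range_from_nat_into) (auto simp: countable_finite)
  have "\<forall>x\<in>carrier R. \<exists>p. shape_eval R g (fst p) (snd p) = x"
    using generate_ring_shape[OF _ g] gen by fastforce
  then obtain p where p: "\<And>x. x \<in> carrier R \<Longrightarrow> shape_eval R g (fst (p x)) (snd (p x)) = x"
    by metis
  define h where "h x = (\<lambda>n. if even n then (if n = 2 * to_nat (fst (p x)) then \<one>\<^bsub>K\<^esub> else \<zero>\<^bsub>K\<^esub>)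
                               else snd (p x) (n div 2))" for x
  have "inj_on h (carrier R)"
  proof
    fix x y assume xy: "x \<in> carrier R" "y \<in> carrier R" and eq: "h x = h y"
    have "h y (2 * to_nat (fst (p x))) = \<one>\<^bsub>K\<^esub>"
      using eq by (metis dvd_triv_left h_def)
    then have "fst (p x) = fst (p y)"
      by (auto simp: h_def split: if_splits)
    moreover have "snd (p x) n = snd (p y) n" for n
      using fun_cong[OF eq, of "2 * n + 1"] by (simp add: h_def)
    ultimately show "x = y" using p[OF xy(1)] p[OF xy(2)] by (metis ext)
  qed
  then show ?thesis by blast
qed

lemma (in linear_map) dim_eq_of_bij:
  assumes inj: "inj_on T (carrier V)" and surj: "T ` carrier V = carrier W"
  shows "V.dim = W.dim"
proof (cases V.fin_dim)
  case True
  then show ?thesis using dim_eq inj surj by blast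
next
  case False
  let ?T = "inv_into (carrier V) T"
  have bij: "bij_betw T (carrier V) (carrier W)"
    using inj surj by (simp add: bij_betw_def)
  have im: "?T ` carrier W = carrier V" using bij by (metis bij_betw_def bij_betw_inv_into)
  interpret T': linear_map K W V ?T
  proof (intro_locales, unfold_locales)
    show "?T \<in> LinearCombinations.module_hom K W V"
      unfolding LinearCombinations.module_hom_def
    proof (safe)
      fix x assume "x \<in> carrier W" then show "?T x \<in> carrier V" using im by blast
    next
      fix x y assume "x \<in> carrier W" "y \<in> carrier W"
      then obtain u v where "u \<in> carrier V" "v \<in> carrier V" "x = T u" "y = T v"
        using surj by blast
      then show "?T (x \<oplus>\<^bsub>W\<^esub> y) = ?T x \<oplus>\<^bsub>V\<^esub> ?T y"
        using inj by (metis V.module.M.a_closed f_add inv_into_f_f)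
    next
      fix c x assume "c \<in> carrier K" "x \<in> carrier W"
      then obtain u where "u \<in> carrier V" "x = T u"
        using surj by blast
      then show "?T (c \<odot>\<^bsub>W\<^esub> x) = c \<odot>\<^bsub>V\<^esub> ?T x"
        using inj \<open>c \<in> carrier K\<close> by (metis V.module.smult_closed f_smult inv_into_f_f)
    qed
  qed
  have "\<not> W.fin_dim" using False T'.surj_fin_dim[OF _ im] by blast
  then have "(\<exists>A. finite A \<and> card A = n \<and> A \<subseteq> carrier V \<and> V.module.span A = carrier V) \<longleftrightarrow>
             (\<exists>A. finite A \<and> card A = n \<and> A \<subseteq> carrier W \<and> W.module.span A = carrier W)" for n
    using False unfolding V.fin_dim_def W.fin_dim_def by blast
  then show ?thesis unfolding V.dim_def W.dim_def by presburger
qed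

definition transport :: "('b \<Rightarrow> 'c) \<Rightarrow> ('a, 'b, 'x) module_scheme \<Rightarrow> ('a, 'c) module" where
  "transport h R = (let k = inv_into (carrier R) h in
     \<lparr>carrier = h ` carrier R,
      monoid.mult = (\<lambda>x y. h (k x \<otimes>\<^bsub>R\<^esub> k y)), one = h \<one>\<^bsub>R\<^esub>,
      zero = h \<zero>\<^bsub>R\<^esub>, add = (\<lambda>x y. h (k x \<oplus>\<^bsub>R\<^esub> k y)),
      module.smult = (\<lambda>c x. h (c \<odot>\<^bsub>R\<^esub> k x))\<rparr>)"

lemma (in algebra) transport_algebra:
  assumes inj: "inj_on h (carrier M)"
  shows "algebra R (transport h M)" and "h \<in> ring_hom M (transport h M)"
    and "h \<in> LinearCombinations.module_hom R M (transport h M)"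
proof -
  have [simp]: "inv_into (carrier M) h (h x) = x" if "x \<in> carrier M" for x
    using inj that by simp
  show "algebra R (transport h M)"
  proof (rule algebraI)
    have "\<exists>y\<in>carrier M. h (y \<oplus>\<^bsub>M\<^esub> x) = h \<zero>\<^bsub>M\<^esub>" if "x \<in> carrier M" for x
      using that by (metis M.add.inv_closed M.l_neg)
    then have "abelian_group (transport h M)"
      by (intro abelian_groupI) (auto simp: transport_def Let_def M.a_ac)
    moreover have "comm_monoid (transport h M)"
      by (intro comm_monoidI) (auto simp: transport_def Let_def m_ac)
    ultimately show "cring (transport h M)"
      by (intro cringI) (auto simp: transport_def Let_def l_distr)
  qed (auto simp: transport_def Let_def smult_l_distr smult_r_distr smult_assoc1 smult_assoc2
      intro: R_cring)
  show "h \<in> ring_hom M (transport h M)"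
    by (intro ring_hom_memI) (auto simp: transport_def Let_def)
  show "h \<in> LinearCombinations.module_hom R M (transport h M)"
    by (auto simp: transport_def Let_def LinearCombinations.module_hom_def)
qed

lemma (in standard_graded_algebra) transport_standard_graded_algebra:
  assumes inj: "inj_on h (carrier R)"
  shows "standard_graded_algebra K (transport h R) (\<lambda>i. h ` G i)"
    and "graded_algebra.hilbert_function K (transport h R) (\<lambda>i. h ` G i) = hilbert_function"
proof -
  let ?R = "transport h R" and ?k = "inv_into (carrier R) h"
  have R': "algebra K ?R" by (rule transport_algebra[OF inj])
  have K: "field K" ..
  have V': "vectorspace K ?R" by (intro vectorspace.intro algebra.module[OF R'] K)
  have V: "vectorspace K R" by (intro vectorspace.intro module K)
  have hom: "ring_hom_cring R ?R h"
    by (intro ring_hom_cring.intro ring_hom_cring_axioms.intro transport_algebra(2)[OF inj]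
        M_cring algebra.M_cring[OF R'])
  note T2 = transport_algebra(2)[OF inj]
  have add: "h (x \<oplus>\<^bsub>R\<^esub> y) = h x \<oplus>\<^bsub>?R\<^esub> h y" if "x \<in> carrier R" "y \<in> carrier R" for x y
    by (rule ring_hom_add[OF T2 that])
  have mult: "h (x \<otimes>\<^bsub>R\<^esub> y) = h x \<otimes>\<^bsub>?R\<^esub> h y" if "x \<in> carrier R" "y \<in> carrier R" for x y
    by (rule ring_hom_mult[OF T2 that])
  have a_inv: "h (\<ominus>\<^bsub>R\<^esub> x) = \<ominus>\<^bsub>?R\<^esub> h x" if "x \<in> carrier R" for x
    by (rule ring_hom_cring.hom_a_inv[OF hom that])
  have finsum: "h (\<Oplus>\<^bsub>R\<^esub>i\<in>A. f i) = (\<Oplus>\<^bsub>?R\<^esub>i\<in>A. (h \<circ> f) i)"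
    if "f \<in> A \<rightarrow> carrier R" for f and A :: "nat set"
    by (rule ring_hom_cring.hom_finsum[OF hom that])
  have one: "h \<one>\<^bsub>R\<^esub> = \<one>\<^bsub>?R\<^esub>" by (rule ring_hom_one[OF T2])
  have zero: "h \<zero>\<^bsub>R\<^esub> = \<zero>\<^bsub>?R\<^esub>" by (rule ring_hom_cring.hom_zero[OF hom])
  note hom_simps = zero one add mult a_inv finsum
  have smult: "h (c \<odot>\<^bsub>R\<^esub> x) = c \<odot>\<^bsub>?R\<^esub> h x" if "c \<in> carrier K" "x \<in> carrier R" for c x
    using transport_algebra(3)[OF inj] that by (auto simp: LinearCombinations.module_hom_def)
  have car: "carrier ?R = h ` carrier R" by (simp add: transport_def Let_def)
  have k: "?k (h x) = x" if "x \<in> carrier R" for x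
    using inj that by simp
  have sub: "submodule K (G i) R" for i
    using component_subspace by (simp add: VectorSpace.subspace_def)
  have GR: "x \<in> carrier R" if "x \<in> G i" for x i
    using submodule.subset[OF sub] that by blast
  have sub': "submodule K (h ` G i) ?R" for i
  proof (rule submodule.intro)
    show "Module.module K ?R" by (rule algebra.module[OF R'])
    show "h ` G i \<subseteq> carrier ?R" using GR car by blast
    fix v w assume "v \<in> h ` G i" "w \<in> h ` G i"
    then obtain x y where xy: "x \<in> G i" "y \<in> G i" "v = h x" "w = h y" by blast
    have "v \<oplus>\<^bsub>?R\<^esub> w = h (x \<oplus>\<^bsub>R\<^esub> y)"
      using xy GR[OF xy(1)] GR[OF xy(2)] by (simp add: hom_simps)
    then show "v \<oplus>\<^bsub>?R\<^esub> w \<in> h ` G i"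
      using submodule.m_closed[OF sub] xy by simp
  next
    show "\<zero>\<^bsub>?R\<^esub> \<in> h ` G i"
      using submodule.zero_closed[OF sub] hom_simps(1) by (metis imageI)
  next
    fix c v assume "c \<in> carrier K" "v \<in> h ` G i"
    then obtain x where x: "c \<in> carrier K" "x \<in> G i" "v = h x" by blast
    have "c \<odot>\<^bsub>?R\<^esub> v = h (c \<odot>\<^bsub>R\<^esub> x)" using x GR[OF x(2)] by (simp add: smult)
    then show "c \<odot>\<^bsub>?R\<^esub> v \<in> h ` G i"
      using submodule.smult_closed[OF sub] x by simp
  qed
  have zero_iff: "h x = \<zero>\<^bsub>?R\<^esub> \<longleftrightarrow> x = \<zero>\<^bsub>R\<^esub>" if "x \<in> carrier R" for x
    using that inj by (metis hom_simps(1) inj_onD M.zero_closed)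
  show graded: "standard_graded_algebra K ?R (\<lambda>i. h ` G i)"
  proof (intro standard_graded_algebra.intro graded_algebra.intro R' K
      graded_algebra_axioms.intro standard_graded_algebra_axioms.intro)
    show "VectorSpace.subspace K (h ` G i) ?R" for i
      using sub' V' by (simp add: VectorSpace.subspace_def)
    fix x y i j assume "x \<in> h ` G i" "y \<in> h ` G j"
    then obtain u v where uv: "u \<in> G i" "v \<in> G j" "x = h u" "y = h v" by blast
    have "x \<otimes>\<^bsub>?R\<^esub> y = h (u \<otimes>\<^bsub>R\<^esub> v)" using uv GR[OF uv(1)] GR[OF uv(2)] by (simp add: hom_simps)
    then show "x \<otimes>\<^bsub>?R\<^esub> y \<in> h ` G (i + j)" using component_mult uv by simp
  next
    fix x assume "x \<in> carrier ?R"
    then obtain u where u: "u \<in> carrier R" "x = h u" using car by blast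
    let ?P = "\<lambda>f. (\<forall>i. f i \<in> G i) \<and> finite {i. f i \<noteq> \<zero>\<^bsub>R\<^esub>} \<and>
           u = (\<Oplus>\<^bsub>R\<^esub>i\<in>{i. f i \<noteq> \<zero>\<^bsub>R\<^esub>}. f i)"
    let ?Q = "\<lambda>f. (\<forall>i. f i \<in> h ` G i) \<and> finite {i. f i \<noteq> \<zero>\<^bsub>?R\<^esub>} \<and>
           x = (\<Oplus>\<^bsub>?R\<^esub>i\<in>{i. f i \<noteq> \<zero>\<^bsub>?R\<^esub>}. f i)"
    have PQ: "?P f \<longleftrightarrow> ?Q (h \<circ> f)" if "\<forall>i. f i \<in> G i" for f
    proof -
      have f: "f i \<in> carrier R" for i using that GR by blast
      have "u = (\<Oplus>\<^bsub>R\<^esub>i\<in>{i. f i \<noteq> \<zero>\<^bsub>R\<^esub>}. f i) \<longleftrightarrow> h u = h (\<Oplus>\<^bsub>R\<^esub>i\<in>{i. f i \<noteq> \<zero>\<^bsub>R\<^esub>}. f i)"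
        using f by (intro inj_on_eq_iff[OF inj, symmetric] u M.finsum_closed) auto
      then show ?thesis using that f by (auto simp: zero_iff u comp_def hom_simps)
    qed
    obtain f where f: "?P f" and uniq: "\<And>f'. ?P f' \<Longrightarrow> f' = f"
      using direct_sum[OF u(1)] by (auto elim!: ex1E) 
    show "\<exists>!f. ?Q f"
    proof
      show "?Q (h \<circ> f)" using f PQ by blast
    next
      fix f' assume f': "?Q f'"
      then have "\<forall>i. \<exists>y. y \<in> G i \<and> f' i = h y" by blast
      then obtain f'' where f'': "\<forall>i. f'' i \<in> G i" "\<And>i. f' i = h (f'' i)" by metis
      then have "f' = h \<circ> f''" by auto
      then show "f' = h \<circ> f" using PQ[OF f''(1)] f' uniq by blast
    qed
  next
    obtain S where S: "S \<subseteq> G 1" "finite S"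
      and gen: "generate_ring R ((\<lambda>c. c \<odot>\<^bsub>R\<^esub> \<one>\<^bsub>R\<^esub>) ` carrier K \<union> S) = carrier R"
      using generated_in_degree_one by blast
    let ?H = "(\<lambda>c. c \<odot>\<^bsub>R\<^esub> \<one>\<^bsub>R\<^esub>) ` carrier K \<union> S"
    let ?H' = "(\<lambda>c. c \<odot>\<^bsub>?R\<^esub> \<one>\<^bsub>?R\<^esub>) ` carrier K \<union> h ` S"
    have HR: "?H \<subseteq> carrier R" using S GR by auto
    have "h x \<in> generate_ring ?R ?H'" if "x \<in> generate_ring R ?H" for x
      using that
    proof induction
      case one
      show ?case using generate_ring.one[of ?R ?H'] by (simp add: hom_simps)
    next
      case (incl x)
      then have "h x \<in> ?H'"
      proof
        assume "x \<in> (\<lambda>c. c \<odot>\<^bsub>R\<^esub> \<one>\<^bsub>R\<^esub>) ` carrier K"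
        then show ?thesis using smult hom_simps(2) by auto
      qed simp
      then show ?case by (rule generate_ring.incl)
    next
      case (a_inv x)
      then show ?case using generate_ring.a_inv[of "h x" ?R ?H'] gen by (simp add: hom_simps)
    next
      case (eng_add x y)
      then show ?case using generate_ring.eng_add[of "h x" ?R ?H' "h y"] gen by (simp add: hom_simps)
    next
      case (eng_mult x y)
      then show ?case using generate_ring.eng_mult[of "h x" ?R ?H' "h y"] gen by (simp add: hom_simps)
    qed
    then have "carrier ?R \<subseteq> generate_ring ?R ?H'" using gen car by auto
    moreover have "c \<odot>\<^bsub>?R\<^esub> \<one>\<^bsub>?R\<^esub> \<in> carrier ?R" if "c \<in> carrier K" for c
      using that smult[of c "\<one>\<^bsub>R\<^esub>"] one car by (metis cring.cring_simprules(6)[OF M_cring] imageI smult_closed)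
    then have "?H' \<subseteq> carrier ?R" using S GR car by auto
    ultimately have "generate_ring ?R ?H' = carrier ?R"
      using ring.generate_ring_incl[OF cring.axioms(1)[OF algebra.M_cring[OF R']]] by blast
    then show "\<exists>S\<subseteq>h ` G 1. finite S \<and>
       generate_ring ?R ((\<lambda>c. c \<odot>\<^bsub>?R\<^esub> \<one>\<^bsub>?R\<^esub>) ` carrier K \<union> S) = carrier ?R"
      using S by (intro exI[of _ "h ` S"]) auto
  qed
  interpret R': standard_graded_algebra K ?R "\<lambda>i. h ` G i" by (rule graded)
  show "R'.hilbert_function = hilbert_function"
  proof
    fix i
    interpret Vi: vectorspace K "R\<lparr>carrier := G i\<rparr>"
      by (rule vectorspace.subspace_is_vs[OF V component_subspace])
    interpret Wi: vectorspace K "?R\<lparr>carrier := h ` G i\<rparr>"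
      by (rule vectorspace.subspace_is_vs[OF V' R'.component_subspace])
    interpret linear_map K "R\<lparr>carrier := G i\<rparr>" "?R\<lparr>carrier := h ` G i\<rparr>" h
    proof (unfold_locales)
      show "h \<in> LinearCombinations.module_hom K (R\<lparr>carrier := G i\<rparr>) (?R\<lparr>carrier := h ` G i\<rparr>)"
        using GR smult by (auto simp: hom_simps LinearCombinations.module_hom_def)
    qed
    have "inj_on h (G i)" using inj GR by (meson inj_on_subset subsetI)
    then show "R'.hilbert_function i = hilbert_function i"
      unfolding R'.hilbert_function_def hilbert_function_def
      using dim_eq_of_bij by simp
  qed
qed

lemma is_hilbert_polynomialI:
  assumes "standard_graded_algebra K R G"
    and "graded_algebra.has_hilbert_polynomial K R G f"
  shows "is_hilbert_polynomial K f"
proof -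
  interpret standard_graded_algebra K R G by fact
  obtain h :: "'c \<Rightarrow> nat \<Rightarrow> 'a" where h: "inj_on h (carrier R)"
    using embeds_in_sequences by blast
  note T = transport_standard_graded_algebra[OF h]
  interpret R': standard_graded_algebra K "transport h R" "\<lambda>i. h ` G i" by (rule T)
  have "R'.has_hilbert_polynomial f"
    using assms(2) T(2) unfolding R'.has_hilbert_polynomial_def has_hilbert_polynomial_def by simp
  then show ?thesis unfolding is_hilbert_polynomial_def using T(1) by blast
qed

end

theory Submission
  imports Defs "HOL-Library.Function_Algebras"
begin

text \<open>
  Segre products of polynomial rings in two variables have Hilbert polynomial \<open>(x + 1) ^ j\<close>; adjoining
  a variable \<open>z\<close> with \<open>z ^ m = 0\<close> gives \<open>\<Sum>k<m. (x + 1 - k) ^ j\<close>, and fibre products over \<open>k\<close> add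
  Hilbert polynomials. So every \<open>\<Sum>j\<le>d. \<Sum>k<m j. (x + 1 - k) ^ j\<close> is a Hilbert polynomial. An integer
  polynomial with large leading coefficient \<open>n\<close> is of this form: split off \<open>\<Sum>k<n. (x + 1 - k) ^ d\<close>. The
  remainder has degree \<open>d - 1\<close> and a leading coefficient of order \<open>d * n ^ 2 / 2\<close>, which dominates its
  other coefficients, so the procedure continues down to degree \<open>0\<close>.
\<close>

section \<open>Algebras of partial monoids\<close>

lemma (in abelian_monoid) finsum_fibres:
  assumes "finite T" "finite I" "\<phi> ` T \<subseteq> I" "g \<in> T \<rightarrow> carrier G"
  shows "(\<Oplus>i\<in>I. \<Oplus>t\<in>{t \<in> T. \<phi> t = i}. g t) = (\<Oplus>t\<in>T. g t)"
proof -
  have "(\<Union>i\<in>I. {t \<in> T. \<phi> t = i}) = T" using assms(3) by auto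
  moreover have "pairwise (\<lambda>i j. disjnt {t \<in> T. \<phi> t = i} {t \<in> T. \<phi> t = j}) I"
    by (auto simp: pairwise_def disjnt_def)
  ultimately show ?thesis
    using add.finprod_UN_disjoint[of I "\<lambda>i. {t \<in> T. \<phi> t = i}" g] assms
    by (simp add: Pi_iff)
qed

lemma (in abelian_monoid) finsum_single:
  assumes "finite I" "i \<in> I" "f i \<in> carrier G" "\<And>j. j \<in> I \<Longrightarrow> j \<noteq> i \<Longrightarrow> f j = \<zero>"
  shows "(\<Oplus>j\<in>I. f j) = f i"
proof -
  have "(\<Oplus>j\<in>I. f j) = (\<Oplus>j\<in>I. if i = j then f j else \<zero>)"
    using assms by (intro finsum_cong') auto
  also have "\<dots> = (\<Oplus>j\<in>I. if i = j then f i else \<zero>)"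
    using assms(3) by (intro finsum_cong') auto
  also have "\<dots> = f i"
    using add.finprod_singleton[of i I "\<lambda>_. f i"] assms by simp
  finally show ?thesis .
qed

text \<open>
  The algebra with basis \<open>B\<close>: the product of two basis elements is their sum if that lies in \<open>B\<close>,
  and \<open>0\<close> otherwise. Applying \<open>B_assoc\<close> to all orderings of \<open>u, v, w\<close> is what makes it associative.
\<close>

locale partial_monoid_algebra = field K
  for K :: "('a, 'm) ring_scheme" (structure) +
  fixes B :: "'b::comm_monoid_add set" and deg :: "'b \<Rightarrow> nat"
  assumes zero_in_B: "0 \<in> B"
    and B_assoc: "\<lbrakk>u \<in> B; v \<in> B; w \<in> B; u + v + w \<in> B\<rbrakk> \<Longrightarrow> u + v \<in> B"
    and deg_add: "\<lbrakk>u \<in> B; v \<in> B; u + v \<in> B\<rbrakk> \<Longrightarrow> deg (u + v) = deg u + deg v"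
    and finite_degree: "finite {u \<in> B. deg u = i}"
    and degree_0: "\<lbrakk>u \<in> B; deg u = 0\<rbrakk> \<Longrightarrow> u = 0"
    and degree_Suc: "\<lbrakk>u \<in> B; deg u = Suc i\<rbrakk> \<Longrightarrow> \<exists>g\<in>B. \<exists>v\<in>B. deg g = 1 \<and> deg v = i \<and> u = g + v"
begin

section \<open>Convolution product and the algebra axioms\<close>

definition splits :: "'b \<Rightarrow> ('b \<times> 'b) set" where
  "splits w = {(u, v). u \<in> B \<and> v \<in> B \<and> u + v = w}"

text \<open>Elements are finitely supported functions on the whole type that vanish off
  \<open>B\<close>, so that equality of elements is equality of functions. The product is
  convolution, cut off outside \<open>B\<close>.\<close>

definition A :: "('a, 'b \<Rightarrow> 'a) module" where
  "A = \<lparr>carrier = {f. range f \<subseteq> carrier K \<and> (\<forall>u. u \<notin> B \<longrightarrow> f u = \<zero>) \<and> finite {u. f u \<noteq> \<zero>}},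
        monoid.mult = (\<lambda>f g w. if w \<in> B then \<Oplus>p\<in>splits w. f (fst p) \<otimes> g (snd p) else \<zero>),
        one = (\<lambda>u. if u = 0 then \<one> else \<zero>),
        zero = (\<lambda>_. \<zero>),
        add = (\<lambda>f g u. f u \<oplus> g u),
        module.smult = (\<lambda>c f u. c \<otimes> f u)\<rparr>"

definition G :: "nat \<Rightarrow> ('b \<Rightarrow> 'a) set" where
  "G i = {f \<in> carrier A. \<forall>u. deg u \<noteq> i \<longrightarrow> f u = \<zero>}"

definition \<delta> :: "'b \<Rightarrow> 'b \<Rightarrow> 'a" where
  "\<delta> w u = (if u = w then \<one> else \<zero>)"

text \<open>Both parts of a splitting have degree at most \<open>deg w\<close>, and only finitely
  many basis elements have bounded degree.\<close>

lemma finite_splits: assumes "w \<in> B" shows "finite (splits w)"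
proof -
  have "finite (\<Union>i\<le>deg w. {u \<in> B. deg u = i})" using finite_degree by blast
  moreover have "splits w \<subseteq> (\<Union>i\<le>deg w. {u \<in> B. deg u = i}) \<times> (\<Union>i\<le>deg w. {u \<in> B. deg u = i})"
    using assms deg_add by (fastforce simp: splits_def)
  ultimately show ?thesis by (meson finite_SigmaI finite_subset)
qed

lemma zero_A: "\<zero>\<^bsub>A\<^esub> = (\<lambda>_. \<zero>)" by (simp add: A_def)
lemma one_A: "\<one>\<^bsub>A\<^esub> = \<delta> 0" by (simp add: A_def \<delta>_def fun_eq_iff)
lemma add_A: "f \<oplus>\<^bsub>A\<^esub> g = (\<lambda>u. f u \<oplus> g u)" by (simp add: A_def)
lemma smult_A: "c \<odot>\<^bsub>A\<^esub> f = (\<lambda>u. c \<otimes> f u)" by (simp add: A_def)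
lemma mult_A: "f \<otimes>\<^bsub>A\<^esub> g = (\<lambda>w. if w \<in> B then \<Oplus>p\<in>splits w. f (fst p) \<otimes> g (snd p) else \<zero>)"
  by (simp add: A_def)

lemma carrier_A: "f \<in> carrier A \<longleftrightarrow>
    (\<forall>u. f u \<in> carrier K) \<and> (\<forall>u. u \<notin> B \<longrightarrow> f u = \<zero>) \<and> finite {u. f u \<noteq> \<zero>}"
  by (auto simp: A_def)

lemma A_value: "f \<in> carrier A \<Longrightarrow> f u \<in> carrier K" by (simp add: carrier_A)

lemma \<delta>_closed: "w \<in> B \<Longrightarrow> \<delta> w \<in> carrier A" by (auto simp: carrier_A \<delta>_def)

lemma add_closed_A:
  assumes "f \<in> carrier A" "g \<in> carrier A" shows "f \<oplus>\<^bsub>A\<^esub> g \<in> carrier A"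
proof -
  have "{u. f u \<oplus> g u \<noteq> \<zero>} \<subseteq> {u. f u \<noteq> \<zero>} \<union> {u. g u \<noteq> \<zero>}" by auto
  then have "finite {u. f u \<oplus> g u \<noteq> \<zero>}" using assms by (auto simp: carrier_A intro: finite_subset)
  then show ?thesis using assms by (simp add: carrier_A add_A)
qed

lemma smult_closed_A:
  assumes "c \<in> carrier K" "f \<in> carrier A" shows "c \<odot>\<^bsub>A\<^esub> f \<in> carrier A"
proof -
  have "{u. c \<otimes> f u \<noteq> \<zero>} \<subseteq> {u. f u \<noteq> \<zero>}" using assms by auto
  then have "finite {u. c \<otimes> f u \<noteq> \<zero>}" using assms by (auto simp: carrier_A intro: finite_subset)
  then show ?thesis using assms by (simp add: carrier_A smult_A)
qed

text \<open>The support of a product lies in the sum of the supports. This yields both the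
  finiteness of the support in \<open>mult_closed_A\<close> and the additivity of degrees in
  \<open>mult_G\<close>.\<close>

lemma mult_nonzero:
  assumes "f \<in> carrier A" "g \<in> carrier A" "(f \<otimes>\<^bsub>A\<^esub> g) w \<noteq> \<zero>"
  obtains u v where "u \<in> B" "v \<in> B" "w \<in> B" "w = u + v" "f u \<noteq> \<zero>" "g v \<noteq> \<zero>"
proof -
  have "w \<in> B" using assms(3) by (auto simp: mult_A split: if_splits)
  have "\<exists>p\<in>splits w. f (fst p) \<otimes> g (snd p) \<noteq> \<zero>"
  proof (rule ccontr)
    assume "\<not> ?thesis"
    then have "(\<Oplus>p\<in>splits w. f (fst p) \<otimes> g (snd p)) = \<zero>"
      by (intro add.finprod_one_eqI) auto
    then show False using assms(3) by (simp add: mult_A \<open>w \<in> B\<close>)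
  qed
  then obtain p where p: "p \<in> splits w" "f (fst p) \<otimes> g (snd p) \<noteq> \<zero>" by blast
  have "f (fst p) \<noteq> \<zero>" "g (snd p) \<noteq> \<zero>"
    using p(2) A_value[OF assms(1)] A_value[OF assms(2)] by auto
  with p(1) \<open>w \<in> B\<close> show ?thesis
    by (intro that[of "fst p" "snd p"]) (auto simp: splits_def)
qed

lemma mult_closed_A:
  assumes "f \<in> carrier A" "g \<in> carrier A" shows "f \<otimes>\<^bsub>A\<^esub> g \<in> carrier A"
proof -
  have "{w. (f \<otimes>\<^bsub>A\<^esub> g) w \<noteq> \<zero>} \<subseteq> (\<lambda>(u, v). u + v) ` ({u. f u \<noteq> \<zero>} \<times> {v. g v \<noteq> \<zero>})"
    by (auto elim!: mult_nonzero[OF assms])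
  moreover have "finite ({u. f u \<noteq> \<zero>} \<times> {v. g v \<noteq> \<zero>})"
    using assms by (simp add: carrier_A)
  ultimately have "finite {w. (f \<otimes>\<^bsub>A\<^esub> g) w \<noteq> \<zero>}" by (meson finite_imageI finite_subset)
  moreover have "(f \<otimes>\<^bsub>A\<^esub> g) w \<in> carrier K" for w
    using A_value[OF assms(1)] A_value[OF assms(2)] by (auto simp: mult_A intro!: finsum_closed)
  ultimately show ?thesis by (auto simp: carrier_A mult_A)
qed

lemma mult_comm_A:
  assumes "f \<in> carrier A" "g \<in> carrier A" shows "f \<otimes>\<^bsub>A\<^esub> g = g \<otimes>\<^bsub>A\<^esub> f"
proof
  fix w
  have swap: "splits w = prod.swap ` splits w"
    by (auto simp: splits_def add.commute image_iff)
  have "(\<Oplus>p\<in>splits w. f (fst p) \<otimes> g (snd p)) = (\<Oplus>p\<in>splits w. f (snd p) \<otimes> g (fst p))"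
    using A_value[OF assms(1)] A_value[OF assms(2)] by (subst swap, subst add.finprod_reindex) auto
  also have "\<dots> = (\<Oplus>p\<in>splits w. g (fst p) \<otimes> f (snd p))"
    using A_value[OF assms(1)] A_value[OF assms(2)] by (intro finsum_cong') (auto simp: m_comm)
  finally show "(f \<otimes>\<^bsub>A\<^esub> g) w = (g \<otimes>\<^bsub>A\<^esub> f) w" by (simp add: mult_A)
qed

lemma smult_mult_A:
  assumes "c \<in> carrier K" "f \<in> carrier A" "g \<in> carrier A"
  shows "(c \<odot>\<^bsub>A\<^esub> f) \<otimes>\<^bsub>A\<^esub> g = c \<odot>\<^bsub>A\<^esub> (f \<otimes>\<^bsub>A\<^esub> g)"
  using assms(1) A_value[OF assms(2)] A_value[OF assms(3)] by (auto simp: smult_A mult_A m_assoc finsum_rdistr[OF finite_splits] Pi_def)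

lemma add_mult_A:
  assumes "f \<in> carrier A" "g \<in> carrier A" "h \<in> carrier A"
  shows "(f \<oplus>\<^bsub>A\<^esub> g) \<otimes>\<^bsub>A\<^esub> h = f \<otimes>\<^bsub>A\<^esub> h \<oplus>\<^bsub>A\<^esub> g \<otimes>\<^bsub>A\<^esub> h"
  using A_value[OF assms(1)] A_value[OF assms(2)] A_value[OF assms(3)] by (auto simp: add_A mult_A l_distr finsum_addf Pi_def)

lemma one_mult_A:
  assumes "f \<in> carrier A" shows "\<one>\<^bsub>A\<^esub> \<otimes>\<^bsub>A\<^esub> f = f"
proof
  fix w
  show "(\<one>\<^bsub>A\<^esub> \<otimes>\<^bsub>A\<^esub> f) w = f w"
  proof (cases "w \<in> B")
    case True
    have "(\<Oplus>p\<in>splits w. \<delta> 0 (fst p) \<otimes> f (snd p)) = \<delta> 0 (fst (0, w)) \<otimes> f (snd (0, w))"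
      using A_value[OF assms] True zero_in_B finite_splits[OF True]
      by (subst finsum_single[of _ "(0, w)"]) (auto simp: splits_def \<delta>_def)
    then show ?thesis using A_value[OF assms] True by (simp add: one_A mult_A \<delta>_def)
  qed (use assms in \<open>simp add: mult_A carrier_A\<close>)
qed

definition splits3 :: "'b \<Rightarrow> ('b \<times> 'b \<times> 'b) set" where
  "splits3 w = {(u, v, t). u \<in> B \<and> v \<in> B \<and> t \<in> B \<and> u + v + t = w}"

text \<open>The iterated product is brought into a form indexed by triples, where the bracketing is
  no longer visible and the three factors can be permuted.\<close>

lemma mult_mult_A:
  assumes fgh: "f \<in> carrier A" "g \<in> carrier A" "h \<in> carrier A" and w: "w \<in> B"
  shows "((f \<otimes>\<^bsub>A\<^esub> g) \<otimes>\<^bsub>A\<^esub> h) w = (\<Oplus>x\<in>splits3 w. case x of (u, v, t) \<Rightarrow> f u \<otimes> g v \<otimes> h t)"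
proof -
  let ?F = "\<lambda>(u, v, t). f u \<otimes> g v \<otimes> h t"
  \<comment> \<open>Triples are grouped by their outer pair; the fibre over a pair \<open>p\<close>
    consists of the splittings of \<open>fst p\<close>.\<close>
  let ?\<phi> = "\<lambda>(u, v, t). (u + v, t)"
  have fib: "{x \<in> splits3 w. ?\<phi> x = p} = (\<lambda>q. (fst q, snd q, snd p)) ` splits (fst p)"
    if "p \<in> splits w" for p
    using that by (auto simp: splits_def splits3_def image_iff)
  have "finite ((\<lambda>(p, q). (fst q, snd q, snd p)) ` (SIGMA p:splits w. splits (fst p)))"
    using w by (intro finite_imageI finite_SigmaI finite_splits) (auto simp: splits_def)
  moreover have "splits3 w \<subseteq> (\<lambda>(p, q). (fst q, snd q, snd p)) ` (SIGMA p:splits w. splits (fst p))"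
  proof
    fix x assume "x \<in> splits3 w"
    then obtain u v t where x: "x = (u, v, t)" "u \<in> B" "v \<in> B" "t \<in> B" "u + v + t = w"
      by (auto simp: splits3_def)
    \<comment> \<open>\<open>B_assoc\<close> places the inner sum \<open>u + v\<close> in
      \<open>B\<close>, so no triple is lost through the vanishing of an inner product.\<close>
    then have "((u + v, t), (u, v)) \<in> (SIGMA p:splits w. splits (fst p))"
      using B_assoc[of u v t] w by (auto simp: splits_def)
    then show "x \<in> (\<lambda>(p, q). (fst q, snd q, snd p)) ` (SIGMA p:splits w. splits (fst p))"
      using x(1) by force
  qed
  ultimately have fin: "finite (splits3 w)" by (rule finite_subset[rotated])
  have "((f \<otimes>\<^bsub>A\<^esub> g) \<otimes>\<^bsub>A\<^esub> h) w =
      (\<Oplus>p\<in>splits w. (\<Oplus>q\<in>splits (fst p). f (fst q) \<otimes> g (snd q)) \<otimes> h (snd p))"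
    using w fgh[THEN A_value]
    by (auto simp: mult_A splits_def intro!: finsum_cong' finsum_closed)
  also have "\<dots> = (\<Oplus>p\<in>splits w. \<Oplus>x\<in>{x \<in> splits3 w. ?\<phi> x = p}. ?F x)"
  proof (intro finsum_cong' refl)
    fix p assume p: "p \<in> splits w"
    then have "fst p \<in> B" using p by (auto simp: splits_def)
    then have "finite (splits (fst p))" by (rule finite_splits)
    then have "(\<Oplus>q\<in>splits (fst p). f (fst q) \<otimes> g (snd q)) \<otimes> h (snd p)
        = (\<Oplus>q\<in>splits (fst p). f (fst q) \<otimes> g (snd q) \<otimes> h (snd p))"
      using fgh[THEN A_value] by (intro finsum_ldistr) auto
    also have "\<dots> = (\<Oplus>x\<in>{x \<in> splits3 w. ?\<phi> x = p}. ?F x)"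
      unfolding fib[OF p] using fgh[THEN A_value]
      by (subst add.finprod_reindex) (auto intro!: inj_onI)
    finally show "(\<Oplus>q\<in>splits (fst p). f (fst q) \<otimes> g (snd q)) \<otimes> h (snd p) =
      (\<Oplus>x\<in>{x \<in> splits3 w. ?\<phi> x = p}. ?F x)" .
  qed (use fgh[THEN A_value] in \<open>auto intro!: finsum_closed\<close>)
  also have "\<dots> = (\<Oplus>x\<in>splits3 w. ?F x)"
  proof (intro finsum_fibres fin finite_splits w)
    have "u + v \<in> B" if "(u, v, t) \<in> splits3 w" for u v t
      using that w B_assoc[of u v t] by (auto simp: splits3_def)
    then show "?\<phi> ` splits3 w \<subseteq> splits w" by (auto simp: splits_def splits3_def)
  qed (use fgh[THEN A_value] in auto)
  finally show ?thesis .
qed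

text \<open>By commutativity the right-hand side is \<open>(g h) f\<close>, a triple sum of the same
  kind. Rotating the triples and commuting the scalars turns it into the triple sum of the left-hand
  side.\<close>

lemma mult_assoc_A:
  assumes fgh: "f \<in> carrier A" "g \<in> carrier A" "h \<in> carrier A"
  shows "(f \<otimes>\<^bsub>A\<^esub> g) \<otimes>\<^bsub>A\<^esub> h = f \<otimes>\<^bsub>A\<^esub> (g \<otimes>\<^bsub>A\<^esub> h)"
proof
  fix w
  show "((f \<otimes>\<^bsub>A\<^esub> g) \<otimes>\<^bsub>A\<^esub> h) w = (f \<otimes>\<^bsub>A\<^esub> (g \<otimes>\<^bsub>A\<^esub> h)) w"
  proof (cases "w \<in> B")
    case True
    have rot: "splits3 w = (\<lambda>(u, v, t). (v, t, u)) ` splits3 w"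
      by (auto simp: splits3_def image_iff ac_simps)
    have "(f \<otimes>\<^bsub>A\<^esub> (g \<otimes>\<^bsub>A\<^esub> h)) w = ((g \<otimes>\<^bsub>A\<^esub> h) \<otimes>\<^bsub>A\<^esub> f) w"
      by (simp add: mult_comm_A fgh mult_closed_A)
    also have "\<dots> = (\<Oplus>x\<in>splits3 w. case x of (u, v, t) \<Rightarrow> g u \<otimes> h v \<otimes> f t)"
      by (rule mult_mult_A[OF fgh(2,3,1) True])
    also have "\<dots> = (\<Oplus>x\<in>splits3 w. case x of (u, v, t) \<Rightarrow> g v \<otimes> h t \<otimes> f u)"
      using fgh[THEN A_value]
      by (subst rot, subst add.finprod_reindex) (auto intro!: inj_onI finsum_cong')
    also have "\<dots> = (\<Oplus>x\<in>splits3 w. case x of (u, v, t) \<Rightarrow> f u \<otimes> g v \<otimes> h t)"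
      using fgh[THEN A_value] by (intro finsum_cong') (auto simp: m_ac)
    finally show ?thesis by (simp add: mult_mult_A[OF fgh True])
  qed (simp add: mult_A)
qed

lemma algebra_A: "algebra K A"
proof (rule algebraI)
  show "cring K" by (rule is_cring)
  have "\<exists>g\<in>carrier A. g \<oplus>\<^bsub>A\<^esub> f = \<zero>\<^bsub>A\<^esub>" if "f \<in> carrier A" for f
    using that A_value[OF that] smult_closed_A[of "\<ominus> \<one>" f]
    by (intro bexI[of _ "(\<ominus> \<one>) \<odot>\<^bsub>A\<^esub> f"]) (auto simp: add_A smult_A zero_A l_minus l_neg)
  moreover have "\<zero>\<^bsub>A\<^esub> \<in> carrier A" by (simp add: carrier_A zero_A)
  ultimately have "abelian_group A"
    by (intro abelian_groupI add_closed_A) (auto simp: add_A zero_A A_value a_ac)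
  moreover have "\<one>\<^bsub>A\<^esub> \<in> carrier A" by (simp add: one_A \<delta>_closed zero_in_B)
  then have "comm_monoid A"
    by (intro comm_monoidI mult_closed_A mult_assoc_A mult_comm_A one_mult_A)
  ultimately show "cring A" by (intro cringI) (auto simp: add_mult_A)
qed (auto simp: smult_closed_A smult_mult_A, auto simp: A_value smult_A add_A l_distr r_distr m_assoc)

sublocale A: algebra K A by (rule algebra_A)

lemma vectorspace_A: "vectorspace K A"
  by (intro vectorspace.intro A.module_axioms field_axioms)

section \<open>Grading by degree\<close>

lemma finsum_A:
  assumes "finite I" "F \<in> I \<rightarrow> carrier A"
  shows "(\<Oplus>\<^bsub>A\<^esub>i\<in>I. F i) u = (\<Oplus>i\<in>I. F i u)"
  using assms
proof (induction I)
  case (insert i I)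
  then have "(\<Oplus>\<^bsub>A\<^esub>i\<in>insert i I. F i) u = F i u \<oplus> (\<Oplus>\<^bsub>A\<^esub>i\<in>I. F i) u"
    by (subst A.M.finsum_insert) (auto simp: add_A)
  also have "\<dots> = (\<Oplus>i\<in>insert i I. F i u)"
    using insert by (subst finsum_insert) (auto simp: Pi_def intro: A_value)
  finally show ?case .
qed (simp add: zero_A)

lemma G_carrier: "f \<in> G i \<Longrightarrow> f \<in> carrier A" by (simp add: G_def)

lemma submodule_G: "submodule K (G i) A"
proof (rule submodule.intro)
  show "f \<oplus>\<^bsub>A\<^esub> g \<in> G i" if "f \<in> G i" "g \<in> G i" for f g
    using that add_closed_A[of f g] by (simp add: G_def) (simp add: add_A)
  show "c \<odot>\<^bsub>A\<^esub> f \<in> G i" if "c \<in> carrier K" "f \<in> G i" for c f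
    using that smult_closed_A[of c f] by (simp add: G_def) (simp add: smult_A)
  show "\<zero>\<^bsub>A\<^esub> \<in> G i" by (simp add: G_def) (simp add: zero_A)
qed (auto simp: A.module_axioms G_def)

lemma subspace_G: "VectorSpace.subspace K (G i) A"
  by (simp add: VectorSpace.subspace_def vectorspace_A submodule_G)

lemma mult_G:
  assumes "f \<in> G i" "g \<in> G j" shows "f \<otimes>\<^bsub>A\<^esub> g \<in> G (i + j)"
proof -
  have "(f \<otimes>\<^bsub>A\<^esub> g) w = \<zero>" if "deg w \<noteq> i + j" for w
  proof (rule ccontr)
    assume "(f \<otimes>\<^bsub>A\<^esub> g) w \<noteq> \<zero>"
    then obtain u v where "u \<in> B" "v \<in> B" "w \<in> B" "w = u + v" "f u \<noteq> \<zero>" "g v \<noteq> \<zero>"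
      by (rule mult_nonzero[OF assms[THEN G_carrier]])
    then show False using assms deg_add[of u v] that by (auto simp: G_def)
  qed
  then show ?thesis using assms by (simp add: G_def mult_closed_A)
qed

text \<open>The component of degree \<open>i\<close> is \<open>x\<close> cut down to the basis
  elements of degree \<open>i\<close>. It is unique because the value at \<open>u\<close> of any
  homogeneous decomposition comes only from the summand of index \<open>deg u\<close>.\<close>

lemma direct_sum_G:
  assumes x: "x \<in> carrier A"
  shows "\<exists>!f. (\<forall>i. f i \<in> G i) \<and> finite {i. f i \<noteq> \<zero>\<^bsub>A\<^esub>} \<and>
           x = (\<Oplus>\<^bsub>A\<^esub>i\<in>{i. f i \<noteq> \<zero>\<^bsub>A\<^esub>}. f i)"
proof -
  define f0 where "f0 i = (\<lambda>u. if deg u = i then x u else \<zero>)" for i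
  have f0: "f0 i \<in> G i" for i
  proof -
    have "{u. f0 i u \<noteq> \<zero>} \<subseteq> {u. x u \<noteq> \<zero>}" by (auto simp: f0_def)
    then have "finite {u. f0 i u \<noteq> \<zero>}" using x by (auto simp: carrier_A intro: finite_subset)
    then show ?thesis using x by (auto simp: G_def carrier_A f0_def)
  qed
  have char: "x = (\<Oplus>\<^bsub>A\<^esub>i\<in>{i. f i \<noteq> \<zero>\<^bsub>A\<^esub>}. f i) \<longleftrightarrow> f = f0"
    if f: "\<forall>i. f i \<in> G i" and fin: "finite {i. f i \<noteq> \<zero>\<^bsub>A\<^esub>}" for f
  proof -
    have Gv: "f i u \<in> carrier K" for i u using A_value[OF G_carrier] f by blast
    have "(\<Oplus>\<^bsub>A\<^esub>i\<in>{i. f i \<noteq> \<zero>\<^bsub>A\<^esub>}. f i) u = f (deg u) u" for u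
    proof -
      have "(\<Oplus>\<^bsub>A\<^esub>i\<in>{i. f i \<noteq> \<zero>\<^bsub>A\<^esub>}. f i) u = (\<Oplus>i\<in>{i. f i \<noteq> \<zero>\<^bsub>A\<^esub>}. f i u)"
        using f G_carrier by (intro finsum_A fin) auto
      \<comment> \<open>The summand of index \<open>deg u\<close> may be zero and hence missing from
        the index set; adding it does not change the sum and makes the single-term evaluation
        uniform.\<close>
      also have "\<dots> = (\<Oplus>i\<in>insert (deg u) {i. f i \<noteq> \<zero>\<^bsub>A\<^esub>}. f i u)"
        using f Gv fin
        by (intro add.finprod_mono_neutral_cong_left) (auto simp: zero_A)
      also have "\<dots> = f (deg u) u"
        using f Gv fin by (subst finsum_single[of _ "deg u"]) (auto simp: G_def)
      finally show ?thesis .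
    qed
    then have "x = (\<Oplus>\<^bsub>A\<^esub>i\<in>{i. f i \<noteq> \<zero>\<^bsub>A\<^esub>}. f i) \<longleftrightarrow> (\<forall>u. x u = f (deg u) u)"
      by (simp add: fun_eq_iff)
    also have "\<dots> \<longleftrightarrow> f = f0"
      using f by (auto simp: fun_eq_iff f0_def G_def)
    finally show ?thesis .
  qed
  have "{i. f0 i \<noteq> \<zero>\<^bsub>A\<^esub>} \<subseteq> deg ` {u. x u \<noteq> \<zero>}"
    by (auto simp: f0_def zero_A fun_eq_iff split: if_splits)
  then have "finite {i. f0 i \<noteq> \<zero>\<^bsub>A\<^esub>}" using x by (auto simp: carrier_A intro: finite_subset)
  then show ?thesis using f0 char by (intro ex1I[of _ f0]) auto
qed

section \<open>The monomial basis: generation in degree one and dimensions\<close>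

lemma eq_finsum_\<delta>:
  assumes "f \<in> carrier A" "finite U" "U \<subseteq> B" "\<And>u. u \<notin> U \<Longrightarrow> f u = \<zero>"
  shows "f = (\<Oplus>\<^bsub>A\<^esub>u\<in>U. f u \<odot>\<^bsub>A\<^esub> \<delta> u)"
proof
  fix w
  have "(\<Oplus>\<^bsub>A\<^esub>u\<in>U. f u \<odot>\<^bsub>A\<^esub> \<delta> u) w = (\<Oplus>u\<in>U. f u \<otimes> \<delta> u w)"
    using assms(2,3) A_value[OF assms(1)] \<delta>_closed by (subst finsum_A) (auto intro!: smult_closed_A, simp add: smult_A)
  also have "\<dots> = f w"
  proof (cases "w \<in> U")
    case True
    then show ?thesis
      using assms(2,3) A_value[OF assms(1)] by (subst finsum_single[of _ w]) (auto simp: \<delta>_def)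
  next
    case False
    then show ?thesis
      using assms A_value[OF assms(1)] by (subst add.finprod_one_eqI) (auto simp: \<delta>_def)
  qed
  finally show "f w = (\<Oplus>\<^bsub>A\<^esub>u\<in>U. f u \<odot>\<^bsub>A\<^esub> \<delta> u) w" by simp
qed

lemma \<delta>_mult:
  assumes "u \<in> B" "v \<in> B" "u + v \<in> B"
  shows "\<delta> u \<otimes>\<^bsub>A\<^esub> \<delta> v = \<delta> (u + v)"
proof
  fix w
  have other: "\<delta> u (fst p) \<otimes> \<delta> v (snd p) = \<zero>" if "p \<noteq> (u, v)" for p
    using that by (cases p) (auto simp: \<delta>_def)
  show "(\<delta> u \<otimes>\<^bsub>A\<^esub> \<delta> v) w = \<delta> (u + v) w"
  proof (cases "w = u + v")
    case True
    have "(\<Oplus>p\<in>splits w. \<delta> u (fst p) \<otimes> \<delta> v (snd p)) = \<delta> u (fst (u, v)) \<otimes> \<delta> v (snd (u, v))"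
    proof (rule finsum_single)
      show "finite (splits w)" "(u, v) \<in> splits w"
        using assms True by (simp_all add: finite_splits, simp add: splits_def)
    qed (auto simp: other, simp add: \<delta>_def)
    then show ?thesis using assms(3) by (simp add: True mult_A) (simp add: \<delta>_def)
  next
    case False
    then have "(\<Oplus>p\<in>splits w. \<delta> u (fst p) \<otimes> \<delta> v (snd p)) = \<zero>"
      by (intro add.finprod_one_eqI other) (auto simp: splits_def)
    then show ?thesis using False by (simp add: mult_A) (simp add: \<delta>_def)
  qed
qed

text \<open>By \<open>degree_Suc\<close>, a basis element of positive degree is a basis element of
  degree 1 times one of the preceding degree. Induction generates all basis elements; scalars and
  finite sums then give everything.\<close>

lemma standard_graded_algebra_A: "standard_graded_algebra K A G"
proof (intro standard_graded_algebra.intro graded_algebra.intro algebra_A field_axioms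
    graded_algebra_axioms.intro standard_graded_algebra_axioms.intro subspace_G mult_G direct_sum_G)
  define S where "S = \<delta> ` {u \<in> B. deg u = 1}"
  let ?H = "(\<lambda>c. c \<odot>\<^bsub>A\<^esub> \<one>\<^bsub>A\<^esub>) ` carrier K \<union> S"
  have S: "S \<subseteq> G 1" "finite S"
    using finite_degree \<delta>_closed by (auto simp: S_def G_def) (auto simp: \<delta>_def)
  have \<delta>: "\<delta> u \<in> generate_ring A ?H" if "u \<in> B" "deg u = i" for u i
    using that
  proof (induction i arbitrary: u)
    case 0
    then have "\<delta> u = \<one>\<^bsub>A\<^esub>" using degree_0[of u] by (simp add: one_A)
    then show ?case by (simp only: generate_ring.one)
  next
    case (Suc i)
    then obtain g v where gv: "g \<in> B" "v \<in> B" "deg g = 1" "deg v = i" "u = g + v"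
      using degree_Suc by blast
    then have "\<delta> u = \<delta> g \<otimes>\<^bsub>A\<^esub> \<delta> v" using \<delta>_mult Suc.prems by simp
    moreover have "\<delta> g \<in> generate_ring A ?H"
      using gv by (intro generate_ring.incl) (auto simp: S_def)
    ultimately show ?case using Suc.IH gv by (auto intro: generate_ring.eng_mult)
  qed
  have c\<delta>: "c \<odot>\<^bsub>A\<^esub> \<delta> u \<in> generate_ring A ?H" if "c \<in> carrier K" "u \<in> B" for c u
  proof -
    have "c \<odot>\<^bsub>A\<^esub> \<delta> u = (c \<odot>\<^bsub>A\<^esub> \<one>\<^bsub>A\<^esub>) \<otimes>\<^bsub>A\<^esub> \<delta> u"
      using that \<delta>_closed by (simp add: smult_mult_A)
    moreover have "c \<odot>\<^bsub>A\<^esub> \<one>\<^bsub>A\<^esub> \<in> generate_ring A ?H"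
      using that by (intro generate_ring.incl) auto
    ultimately show ?thesis using \<delta>[OF that(2) refl] by (simp only: generate_ring.eng_mult)
  qed
  have fs: "(\<Oplus>\<^bsub>A\<^esub>u\<in>U. F u) \<in> generate_ring A ?H"
    if "finite U" "\<And>u. u \<in> U \<Longrightarrow> F u \<in> generate_ring A ?H \<inter> carrier A"
    for U and F :: "'b \<Rightarrow> 'b \<Rightarrow> 'a"
    using that
  proof (induction U)
    case empty
    \<comment> \<open>The empty sum is obtained as 1 - 1, since zero is not among the introduction
      rules of \<open>generate_ring\<close>.\<close>
    have "\<one>\<^bsub>A\<^esub> \<oplus>\<^bsub>A\<^esub> \<ominus>\<^bsub>A\<^esub> \<one>\<^bsub>A\<^esub> \<in> generate_ring A ?H"
      by (intro generate_ring.eng_add generate_ring.a_inv generate_ring.one)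
    then show ?case by (simp add: A.M.r_neg)
  next
    case (insert u U)
    then show ?case
      by (subst A.M.finsum_insert) (auto intro!: generate_ring.eng_add)
  qed
  have "f \<in> generate_ring A ?H" if f: "f \<in> carrier A" for f
  proof -
    have *: "{u. f u \<noteq> \<zero>} \<subseteq> B" "finite {u. f u \<noteq> \<zero>}" using f by (auto simp: carrier_A)
    have "(\<Oplus>\<^bsub>A\<^esub>u\<in>{u. f u \<noteq> \<zero>}. f u \<odot>\<^bsub>A\<^esub> \<delta> u) \<in> generate_ring A ?H"
      using * A_value[OF f] \<delta>_closed by (intro fs) (auto intro!: c\<delta> smult_closed_A)
    then show ?thesis using eq_finsum_\<delta>[OF f *(2,1)] by simp
  qed
  moreover have "?H \<subseteq> carrier A" using S(1) G_carrier smult_closed_A by auto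
  ultimately have "generate_ring A ?H = carrier A"
    using ring.generate_ring_incl[OF cring.axioms(1)[OF A.M_cring]] by blast
  then show "\<exists>S\<subseteq>G 1. finite S \<and>
      generate_ring A ((\<lambda>c. c \<odot>\<^bsub>A\<^esub> \<one>\<^bsub>A\<^esub>) ` carrier K \<union> S) = carrier A"
    using S by blast
qed

sublocale A: standard_graded_algebra K A G by (rule standard_graded_algebra_A)

text \<open>The functions \<open>\<delta> u\<close> with \<open>u\<close> of degree \<open>i\<close>
  form a basis of \<open>G i\<close>, and \<open>\<delta>\<close> is injective.\<close>

lemma hilbert_function_A: "A.hilbert_function i = card {u \<in> B. deg u = i}"
proof -
  let ?U = "{u \<in> B. deg u = i}"
  interpret V: vectorspace K "A\<lparr>carrier := G i\<rparr>"
    by (rule vectorspace.subspace_is_vs[OF vectorspace_A subspace_G])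
  interpret A: vectorspace K A by (rule vectorspace_A)
  have inj: "inj_on \<delta> X" for X by (intro inj_onI) (metis \<delta>_def one_not_zero)
  have sub: "\<delta> ` ?U \<subseteq> G i" by (auto simp: G_def \<delta>_closed) (auto simp: \<delta>_def)
  then have sub': "\<delta> ` ?U \<subseteq> carrier A" using G_carrier by blast
  have fin: "finite (\<delta> ` ?U)" using finite_degree by simp
  have lc: "A.lincomb a (\<delta> ` ?U) = (\<Oplus>\<^bsub>A\<^esub>u\<in>?U. a (\<delta> u) \<odot>\<^bsub>A\<^esub> \<delta> u)"
    if "a \<in> \<delta> ` ?U \<rightarrow> carrier K" for a
    unfolding A.lincomb_def using that inj \<delta>_closed
    by (intro A.M.finsum_reindex) (auto intro!: smult_closed_A)
  \<comment> \<open>Evaluating a linear combination at \<open>w\<close> reads off the coefficient of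
    \<open>\<delta> w\<close>, which gives linear independence.\<close>
  have lc': "A.lincomb a (\<delta> ` ?U) w = a (\<delta> w)"
    if a: "a \<in> \<delta> ` ?U \<rightarrow> carrier K" and w: "w \<in> ?U" for a w
  proof -
    have ak: "a (\<delta> u) \<in> carrier K" if "u \<in> ?U" for u using a that by auto
    have "A.lincomb a (\<delta> ` ?U) w = (\<Oplus>u\<in>?U. a (\<delta> u) \<otimes> \<delta> u w)"
      unfolding lc[OF a] using a finite_degree \<delta>_closed
      by (subst finsum_A) (auto intro!: smult_closed_A, simp add: smult_A)
    also have "\<dots> = a (\<delta> w)"
      using ak w finite_degree by (subst finsum_single[of _ w]) (auto simp: \<delta>_def)
    finally show ?thesis .
  qed
  have "A.span (\<delta> ` ?U) = G i"
  proof (rule antisym)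
    show "A.span (\<delta> ` ?U) \<subseteq> G i" using A.span_is_subset[OF sub submodule_G] .
    show "G i \<subseteq> A.span (\<delta> ` ?U)"
    proof
      fix f assume f: "f \<in> G i"
      \<comment> \<open>Coefficients in \<open>lincomb\<close> are indexed by vectors rather than by
        basis labels, so \<open>f\<close> is composed with the inverse of
        \<open>\<delta>\<close>.\<close>
      define a where "a x = f (inv_into UNIV \<delta> x)" for x
      have a\<delta>: "a (\<delta> u) = f u" for u using inj by (simp add: a_def)
      have "f = (\<Oplus>\<^bsub>A\<^esub>u\<in>?U. f u \<odot>\<^bsub>A\<^esub> \<delta> u)"
        using f finite_degree by (intro eq_finsum_\<delta>) (auto simp: G_def carrier_A)
      then have "f = A.lincomb a (\<delta> ` ?U)"
        using A_value[OF G_carrier[OF f]] by (subst lc) (auto simp: a\<delta>)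
      moreover have "a \<in> \<delta> ` ?U \<rightarrow> carrier K"
        using A_value[OF G_carrier[OF f]] by (auto simp: a\<delta>)
      ultimately show "f \<in> A.span (\<delta> ` ?U)" using fin A.finite_span[OF fin sub'] by blast
    qed
  qed
  moreover have "A.lin_indpt (\<delta> ` ?U)"
  proof (rule A.finite_lin_indpt2[OF fin sub'])
    fix a assume a: "a \<in> \<delta> ` ?U \<rightarrow> carrier K" "A.lincomb a (\<delta> ` ?U) = \<zero>\<^bsub>A\<^esub>"
    then show "\<forall>v\<in>\<delta> ` ?U. a v = \<zero>" using lc'[OF a(1)] by (auto simp: zero_A)
  qed
  ultimately have "V.basis (\<delta> ` ?U)"
    using sub A.span_li_not_depend[OF sub submodule_G] by (simp add: V.basis_def)
  then have "V.dim = card (\<delta> ` ?U)" using fin by (rule V.dim_basis[rotated])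
  then show ?thesis by (simp add: A.hilbert_function_def card_image inj)
qed

end

section \<open>Algebras with prescribed Hilbert polynomial\<close>

text \<open>
  \<open>block m j\<close> is the part of positive degree of the monomial basis of
  \<open>(k[x\<^sub>1, y\<^sub>1] \<circ> \<dots> \<circ> k[x\<^sub>j, y\<^sub>j])[z] / (z ^ m j)\<close>, where \<open>\<circ>\<close> is the Segre product. Of a monomial \<open>v\<close>,
  the degree is \<open>v (j, 0)\<close>, the exponent of \<open>z\<close> is \<open>v (j, 1)\<close> and the exponent of \<open>x\<^sub>l\<close> is
  \<open>v (j, l + 1)\<close>; the exponent of \<open>y\<^sub>l\<close> is determined by these. The first index keeps the blocks
  for different \<open>j\<close> apart, so that products of elements of different blocks vanish.
\<close>

definition block :: "(nat \<Rightarrow> nat) \<Rightarrow> nat \<Rightarrow> (nat \<times> nat \<Rightarrow> nat) set" where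
  "block m j = {v. (\<forall>i l. v (i, l) \<noteq> 0 \<longrightarrow> i = j \<and> l \<le> j + 1) \<and> 0 < v (j, 0) \<and>
     v (j, 1) < m j \<and> v (j, 1) \<le> v (j, 0) \<and> (\<forall>l\<in>{2..j + 1}. v (j, l) + v (j, 1) \<le> v (j, 0))}"

lemma block_support: "v \<in> block m j \<Longrightarrow> v (i, l) \<noteq> 0 \<Longrightarrow> i = j \<and> l \<le> j + 1"
  unfolding block_def by blast

lemma blockD:
  assumes "v \<in> block m j"
  shows "0 < v (j, 0)" "v (j, 1) < m j" "v (j, 1) \<le> v (j, 0)"
    and "l \<in> {2..j + 1} \<Longrightarrow> v (j, l) + v (j, 1) \<le> v (j, 0)"
  using assms unfolding block_def by blast+

lemma blockI:
  assumes "\<And>i l. v (i, l) \<noteq> 0 \<Longrightarrow> i = j \<and> l \<le> j + 1"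
    and "0 < v (j, 0)" "v (j, 1) < m j" "v (j, 1) \<le> v (j, 0)"
    and "\<And>l. l \<in> {2..j + 1} \<Longrightarrow> v (j, l) + v (j, 1) \<le> v (j, 0)"
  shows "v \<in> block m j"
  using assms unfolding block_def by blast

section \<open>Counting the monomials of a block by degree\<close>

lemma sum_block:
  assumes "v \<in> block m j" "j \<le> d"
  shows "(\<Sum>i\<le>d. v (i, 0)) = v (j, 0)"
proof -
  have "(\<Sum>i\<le>d. v (i, 0)) = (\<Sum>i\<in>{j}. v (i, 0))"
    using assms by (intro sum.mono_neutral_right) (auto simp: block_def)
  then show ?thesis by simp
qed

text \<open>The monomial of degree \<open>i\<close> in block \<open>j\<close> with
  \<open>z\<close>-exponent \<open>k\<close> and \<open>x\<close>-exponents
  \<open>e\<close>.\<close>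

definition block_point :: "nat \<Rightarrow> nat \<Rightarrow> nat \<times> (nat \<Rightarrow> nat) \<Rightarrow> nat \<times> nat \<Rightarrow> nat" where
  "block_point j i = (\<lambda>(k, e) (a, l). if a \<noteq> j \<or> l > j + 1 then 0 else if l = 0 then i else if l = 1 then k else e l)"

text \<open>Once \<open>z ^ k\<close> is split off, every factor of the Segre product has degree
  \<open>i - k\<close>, which bounds the exponent of each \<open>x\<close>. Extensional functions
  are used because \<open>block_point\<close> sees \<open>e\<close> only on
  \<open>{2..j + 1}\<close>; this makes it injective.\<close>

definition block_params :: "(nat \<Rightarrow> nat) \<Rightarrow> nat \<Rightarrow> nat \<Rightarrow> (nat \<times> (nat \<Rightarrow> nat)) set" where
  "block_params m j i = (SIGMA k:{k. k < m j \<and> k \<le> i}. {2..j + 1} \<rightarrow>\<^sub>E {..i - k})"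

lemma block_point_apply:
  "block_point j i (k, e) (a, l) =
     (if a \<noteq> j \<or> l > j + 1 then 0 else if l = 0 then i else if l = 1 then k else e l)"
  by (simp add: block_point_def)

lemma block_point_in_block:
  assumes "x \<in> block_params m j i" "i > 0"
  shows "block_point j i x \<in> block m j"
proof -
  obtain k e where x: "x = (k, e)" and ke: "k < m j" "k \<le> i" "e \<in> {2..j + 1} \<rightarrow>\<^sub>E {..i - k}"
    using assms(1) by (auto simp: block_params_def)
  have "e l + k \<le> i" if "l \<in> {2..j + 1}" for l
    using PiE_mem[OF ke(3) that] ke(2) by simp
  then show ?thesis
    using ke(1,2) assms(2) unfolding x by (auto simp: block_def block_point_apply split: if_splits)
qed

lemma block_point_surj:
  assumes v: "v \<in> block m j"
  obtains x where "x \<in> block_params m j (v (j, 0))" "v = block_point j (v (j, 0)) x"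
proof
  define e where "e = restrict (\<lambda>l. v (j, l)) {2..j + 1}"
  have "v (j, l) \<le> v (j, 0) - v (j, 1)" if "l \<in> {2..j + 1}" for l
  proof -
    have "v (j, l) + v (j, 1) \<le> v (j, 0)" using v that unfolding block_def by blast
    then show ?thesis by linarith
  qed
  then have "e \<in> {2..j + 1} \<rightarrow>\<^sub>E {..v (j, 0) - v (j, 1)}"
    unfolding e_def restrict_PiE_iff atMost_iff by blast
  moreover have "v (j, 1) < m j" "v (j, 1) \<le> v (j, 0)" using v by (simp_all add: block_def)
  ultimately show "(v (j, 1), e) \<in> block_params m j (v (j, 0))"
    unfolding block_params_def by blast
  have "v p = block_point j (v (j, 0)) (v (j, 1), e) p" for p
  proof (cases p)
    case (Pair a l)
    show ?thesis
    proof (cases "a \<noteq> j \<or> l > j + 1")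
      case True
      then have "v (a, l) = 0" using block_support[OF v] by (meson not_le)
      then show ?thesis using True by (simp add: Pair block_point_apply)
    next
      case False
      then show ?thesis by (simp add: Pair block_point_apply e_def)
    qed
  qed
  then show "v = block_point j (v (j, 0)) (v (j, 1), e)" by (rule ext)
qed

lemma inj_on_block_point: "inj_on (block_point j i) (block_params m j i)"
proof (rule inj_onI)
  fix x y assume xy: "x \<in> block_params m j i" "y \<in> block_params m j i"
    and eq: "block_point j i x = block_point j i y"
  obtain k e k' e' where [simp]: "x = (k, e)" "y = (k', e')" by (cases x, cases y)
  have eq: "block_point j i (k, e) (j, l) = block_point j i (k', e') (j, l)" for l using eq by simp
  have "e = e'"
  proof (rule extensionalityI[of _ "{2..j + 1}"])
    fix l assume "l \<in> {2..j + 1}"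
    then show "e l = e' l" using eq[of l] by (simp add: block_point_apply)
  qed (use xy in \<open>auto simp: block_params_def PiE_iff\<close>)
  then show "x = y" using eq[of 1] by (simp add: block_point_apply)
qed

lemma block_degree:
  assumes "i > 0"
  shows "{v \<in> block m j. v (j, 0) = i} = block_point j i ` block_params m j i"
proof
  show "block_point j i ` block_params m j i \<subseteq> {v \<in> block m j. v (j, 0) = i}"
    using block_point_in_block[OF _ assms] by (auto simp: block_point_def)
  show "{v \<in> block m j. v (j, 0) = i} \<subseteq> block_point j i ` block_params m j i"
    using block_point_surj by blast
qed

lemma finite_block_params: "finite (block_params m j i)"
  unfolding block_params_def by (intro finite_SigmaI finite_PiE) auto

lemma card_block_degree:
  assumes "i > 0"
  shows "finite {v \<in> block m j. v (j, 0) = i}"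
    and "card {v \<in> block m j. v (j, 0) = i} = (\<Sum>k | k < m j \<and> k \<le> i. (i + 1 - k) ^ j)"
proof -
  show "finite {v \<in> block m j. v (j, 0) = i}"
    by (simp add: block_degree[OF assms] finite_block_params)
  have "card {v \<in> block m j. v (j, 0) = i} = card (block_params m j i)"
    by (simp add: block_degree[OF assms] card_image inj_on_block_point)
  also have "\<dots> = (\<Sum>k | k < m j \<and> k \<le> i. card ({2..j + 1} \<rightarrow>\<^sub>E {..i - k}))"
    unfolding block_params_def by (intro card_SigmaI) (auto intro!: finite_PiE)
  also have "\<dots> = (\<Sum>k | k < m j \<and> k \<le> i. (i + 1 - k) ^ j)"
    by (intro sum.cong refl) (simp add: card_PiE Suc_diff_le)
  finally show "card {v \<in> block m j. v (j, 0) = i} = (\<Sum>k | k < m j \<and> k \<le> i. (i + 1 - k) ^ j)" .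
qed

text \<open>The fibre product over the field identifies the units of all blocks with the single
  element \<open>0\<close>, the monomial 1.\<close>

definition blocks :: "nat \<Rightarrow> (nat \<Rightarrow> nat) \<Rightarrow> (nat \<times> nat \<Rightarrow> nat) set" where
  "blocks d m = insert 0 (\<Union>j\<le>d. block m j)"

lemma blocks_degree:
  assumes "i > 0"
  shows "{v \<in> blocks d m. (\<Sum>j\<le>d. v (j, 0)) = i} = (\<Union>j\<le>d. {v \<in> block m j. v (j, 0) = i})"
proof (intro equalityI subsetI)
  fix v assume v: "v \<in> {v \<in> blocks d m. (\<Sum>j\<le>d. v (j, 0)) = i}"
  then have "v \<noteq> 0" using assms by auto
  then obtain j where "j \<le> d" "v \<in> block m j" using v by (auto simp: blocks_def)
  then show "v \<in> (\<Union>j\<le>d. {v \<in> block m j. v (j, 0) = i})" using v sum_block[of v m j d] by auto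
next
  fix v assume "v \<in> (\<Union>j\<le>d. {v \<in> block m j. v (j, 0) = i})"
  then obtain j where "j \<le> d" "v \<in> block m j" "v (j, 0) = i" by blast
  then show "v \<in> {v \<in> blocks d m. (\<Sum>j\<le>d. v (j, 0)) = i}"
    using sum_block[of v m j d] by (auto simp: blocks_def)
qed

lemma blocks_degree_0:
  assumes "v \<in> blocks d m" "(\<Sum>j\<le>d. v (j, 0)) = 0" shows "v = 0"
proof (rule ccontr)
  assume "v \<noteq> 0"
  then obtain j where "j \<le> d" "v \<in> block m j" using assms(1) by (auto simp: blocks_def)
  then show False using assms(2) sum_block[of v m j d] by (simp add: block_def)
qed

lemma finite_blocks_degree: "finite {v \<in> blocks d m. (\<Sum>j\<le>d. v (j, 0)) = i}"
proof (cases "i = 0")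
  case True
  then have "{v \<in> blocks d m. (\<Sum>j\<le>d. v (j, 0)) = i} \<subseteq> {0}" using blocks_degree_0 by blast
  then show ?thesis using finite_subset by blast
next
  case False
  then show ?thesis by (simp add: blocks_degree card_block_degree(1))
qed

lemma card_blocks_degree:
  assumes m: "\<And>j. j \<le> d \<Longrightarrow> m j \<le> i" and i: "i > 0"
  shows "int (card {v \<in> blocks d m. (\<Sum>j\<le>d. v (j, 0)) = i}) = (\<Sum>j\<le>d. \<Sum>k<m j. (int i + 1 - int k) ^ j)"
proof -
  have "{v \<in> block m j. v (j, 0) = i} \<inter> {v \<in> block m j'. v (j', 0) = i} = {}" if "j \<noteq> j'" for j j'
  proof -
    \<comment> \<open>Positive degree is essential here: an element of block \<open>j\<close> with
      \<open>v (j', 0) = i > 0\<close> would have support outside its block.\<close>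
    have False if "v \<in> block m j" "v (j', 0) = i" for v
      using \<open>j \<noteq> j'\<close> block_support[OF that(1), of j' 0] that(2) i by simp
    then show ?thesis by blast
  qed
  then have "card (\<Union>j\<le>d. {v \<in> block m j. v (j, 0) = i}) = (\<Sum>j\<le>d. card {v \<in> block m j. v (j, 0) = i})"
    using card_block_degree(1)[OF i] by (intro card_UN_disjoint) auto
  also have "\<dots> = (\<Sum>j\<le>d. \<Sum>k<m j. (i + 1 - k) ^ j)"
  proof (intro sum.cong refl)
    fix j assume "j \<in> {..d}"
    then have "{k. k < m j \<and> k \<le> i} = {..<m j}" using m[of j] by auto
    then show "card {v \<in> block m j. v (j, 0) = i} = (\<Sum>k<m j. (i + 1 - k) ^ j)"
      by (simp add: card_block_degree(2)[OF i])
  qed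
  also have "int \<dots> = (\<Sum>j\<le>d. \<Sum>k<m j. (int i + 1 - int k) ^ j)"
    unfolding of_nat_sum
  proof (intro sum.cong refl)
    fix j k assume "j \<in> {..d}" "k \<in> {..<m j}"
    \<comment> \<open>The truncated difference of naturals agrees with the integer difference in
      this range.\<close>
    then have "k \<le> i + 1" using m[of j] by auto
    then have "int (i + 1 - k) = int i + 1 - int k" by simp
    then show "int ((i + 1 - k) ^ j) = (int i + 1 - int k) ^ j" by (simp only: of_nat_power)
  qed
  finally show ?thesis by (simp only: blocks_degree[OF i])
qed

section \<open>The blocks as a partial monoid\<close>

lemma block_factor:
  assumes u: "u \<in> block m j" "u (j, 0) = Suc i"
  obtains g v where "g \<in> block m j" "g (j, 0) = 1" "v \<in> insert 0 (block m j)" "v (j, 0) = i" "u = g + v"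
proof (cases "i = 0")
  case True
  \<comment> \<open>In degree 1 the cofactor is the unit \<open>0\<close>, which belongs to no
    block.\<close>
  show ?thesis by (rule that[of u 0]) (use u True in auto)
next
  case False
  \<comment> \<open>If \<open>z\<close> divides the monomial, \<open>g\<close> is \<open>z\<close>.
    Otherwise \<open>g\<close> takes one variable from each Segre factor: \<open>x\<close> if it
    divides the monomial, and \<open>y\<close> if not.\<close>
  define g where "g p = (if p = (j, 0) then 1 else if u (j, 1) = 0 then min 1 (u p)
      else if p = (j, 1) then 1 else 0)" for p
  have gu: "g p \<le> u p" for p using u(2) by (simp add: g_def)
  have g0: "g (j, 0) = 1" and g1: "g (j, 1) = min 1 (u (j, 1))"
    by (simp_all add: g_def)
  have gl: "g (j, l) = (if u (j, 1) = 0 then min 1 (u (j, l)) else 0)" if "l \<in> {2..j + 1}" for l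
    using that by (simp_all add: g_def)
  show ?thesis
  proof (rule that[of g "\<lambda>p. u p - g p"])
    show "g \<in> block m j"
    proof (rule blockI)
      show "i = j \<and> l \<le> j + 1" if "g (i, l) \<noteq> 0" for i l
        using block_support[OF u(1), of i l] gu[of "(i, l)"] that by simp
      show "g (j, 1) < m j" using blockD(2)[OF u(1)] gu[of "(j, 1)"] by (rule le_less_trans[rotated])
      show "g (j, l) + g (j, 1) \<le> g (j, 0)" if "l \<in> {2..j + 1}" for l
        unfolding g0 g1 gl[OF that] by simp
      show "g (j, 1) \<le> g (j, 0)" unfolding g0 g1 by simp
    qed (simp add: g0)
    have "(\<lambda>p. u p - g p) \<in> block m j"
    proof (rule blockI)
      show "i = j \<and> l \<le> j + 1" if "u (i, l) - g (i, l) \<noteq> 0" for i l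
        using block_support[OF u(1), of i l] that by simp
      show "0 < u (j, 0) - g (j, 0)" using u(2) False g0 by simp
      show "u (j, 1) - g (j, 1) < m j" using blockD(2)[OF u(1)] by simp
      show "u (j, 1) - g (j, 1) \<le> u (j, 0) - g (j, 0)"
        using blockD(3)[OF u(1)] u(2) unfolding g0 g1 by linarith
      show "u (j, l) - g (j, l) + (u (j, 1) - g (j, 1)) \<le> u (j, 0) - g (j, 0)" if "l \<in> {2..j + 1}" for l
        using blockD(4)[OF u(1) that] u(2) unfolding g0 g1 gl[OF that] by auto
    qed
    then show "(\<lambda>p. u p - g p) \<in> insert 0 (block m j)" by (rule insertI2)
    show "u (j, 0) - g (j, 0) = i" using u(2) g0 by simp
    show "u = g + (\<lambda>p. u p - g p)" using gu by (simp add: fun_eq_iff)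
  qed (rule g0)
qed

text \<open>The nonzero degree coordinates force all blocks to coincide. The linear inequalities
  defining a block are additive; only the bound on the exponent of \<open>z\<close> is not, and it
  is inherited from \<open>u + v + w\<close>.\<close>

lemma block_add:
  assumes u: "u \<in> block m j" and v: "v \<in> block m j'" and w: "u + v + w \<in> block m j''"
  shows "u + v \<in> block m j''"
proof -
  have "j = j''" using block_support[OF w, of j 0] blockD(1)[OF u] by simp
  moreover have "j' = j''" using block_support[OF w, of j' 0] blockD(1)[OF v] by simp
  ultimately have u: "u \<in> block m j''" and v: "v \<in> block m j''" using u v by simp_all
  show ?thesis
  proof (rule blockI)
    show "i = j'' \<and> l \<le> j'' + 1" if "(u + v) (i, l) \<noteq> 0" for i l
      using block_support[OF u, of i l] block_support[OF v, of i l] that by (simp only: plus_fun_apply) auto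
    show "(u + v) (j'', 1) < m j''" using blockD(2)[OF w] by simp
    show "0 < (u + v) (j'', 0)" using blockD(1)[OF u] by simp
    show "(u + v) (j'', 1) \<le> (u + v) (j'', 0)"
      using blockD(3)[OF u] blockD(3)[OF v] by simp
    show "(u + v) (j'', l) + (u + v) (j'', 1) \<le> (u + v) (j'', 0)" if "l \<in> {2..j'' + 1}" for l
      using blockD(4)[OF u that] blockD(4)[OF v that] by simp
  qed
qed

lemma partial_monoid_algebra_blocks:
  assumes "field K"
  shows "partial_monoid_algebra K (blocks d m) (\<lambda>v. \<Sum>j\<le>d. v (j, 0))"
proof (intro partial_monoid_algebra.intro partial_monoid_algebra_axioms.intro assms)
  show "0 \<in> blocks d m" by (simp add: blocks_def)
next
  fix u v w assume *: "u \<in> blocks d m" "v \<in> blocks d m" "w \<in> blocks d m" "u + v + w \<in> blocks d m"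
  show "u + v \<in> blocks d m"
  proof (cases "u = 0 \<or> v = 0 \<or> u + v + w = 0")
    case True
    \<comment> \<open>Exponents are natural numbers, so a sum is zero only if every summand
      is.\<close>
    then have "u = 0 \<or> v = 0 \<or> u + v = 0" by (auto simp: fun_eq_iff)
    then show ?thesis using * by (auto simp: blocks_def)
  next
    case False
    then obtain j j' j'' where j: "u \<in> block m j" "v \<in> block m j'" "u + v + w \<in> block m j''" "j'' \<le> d"
      using * by (auto simp: blocks_def)
    have "u + v \<in> block m j''" by (rule block_add[OF j(1-3)])
    then show ?thesis using j(4) by (auto simp: blocks_def)
  qed
next
  fix u v :: "nat \<times> nat \<Rightarrow> nat"
  show "(\<Sum>j\<le>d. (u + v) (j, 0)) = (\<Sum>j\<le>d. u (j, 0)) + (\<Sum>j\<le>d. v (j, 0))"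
    by (simp add: sum.distrib)
next
  show "finite {u \<in> blocks d m. (\<Sum>j\<le>d. u (j, 0)) = i}" for i by (rule finite_blocks_degree)
  show "u = 0" if "u \<in> blocks d m" "(\<Sum>j\<le>d. u (j, 0)) = 0" for u
    using that by (rule blocks_degree_0)
next
  fix u i assume "u \<in> blocks d m" "(\<Sum>j\<le>d. u (j, 0)) = Suc i"
  then obtain j where j: "j \<le> d" "u \<in> block m j" "u (j, 0) = Suc i"
    using blocks_degree[of "Suc i" d m] by blast
  obtain g v where gv: "g \<in> block m j" "g (j, 0) = 1" "v \<in> insert 0 (block m j)" "v (j, 0) = i" "u = g + v"
    using block_factor[OF j(2,3)] .
  have "(\<Sum>i\<le>d. v (i, 0)) = v (j, 0)" using gv(3) sum_block[OF _ j(1)] by auto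
  then show "\<exists>g\<in>blocks d m. \<exists>v\<in>blocks d m. (\<Sum>j\<le>d. g (j, 0)) = 1 \<and> (\<Sum>j\<le>d. v (j, 0)) = i \<and> u = g + v"
    using gv j(1) sum_block[OF gv(1) j(1)] by (intro bexI[of _ g] bexI[of _ v]) (auto simp: blocks_def)
qed

text \<open>Prescribing \<open>P\<close> by its values at the integers avoids writing out its
  coefficients.\<close>

lemma is_hilbert_polynomial_power_sums:
  fixes K :: "('a, 'm) ring_scheme"
  assumes "field K"
    and P: "\<And>x::int. poly P (of_int x) = of_int (\<Sum>j\<le>d. \<Sum>k<m j. (x + 1 - int k) ^ j)"
  shows "is_hilbert_polynomial K P"
proof -
  interpret partial_monoid_algebra K "blocks d m" "\<lambda>v. \<Sum>j\<le>d. v (j, 0)"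
    by (rule partial_monoid_algebra_blocks) fact
  \<comment> \<open>Beyond every \<open>m j\<close>, all powers of \<open>z\<close> below the cutoff
    occur in degree \<open>i\<close>, so the count is given by the polynomial.\<close>
  have "of_nat (A.hilbert_function i) = poly P (of_nat i)" if "i > Max (m ` {..d})" for i
  proof -
    have "m j \<le> i" if "j \<le> d" for j
      using that by (intro order.trans[OF Max_ge less_imp_le[OF \<open>i > _\<close>]]) auto
    then have "int (A.hilbert_function i) = (\<Sum>j\<le>d. \<Sum>k<m j. (int i + 1 - int k) ^ j)"
      using that by (simp only: hilbert_function_A) (intro card_blocks_degree, auto)
    then have "of_int (int (A.hilbert_function i)) = poly P (of_int (int i))" using P by metis
    then show ?thesis by simp
  qed
  then have "A.has_hilbert_polynomial P"
    unfolding A.has_hilbert_polynomial_def eventually_at_top_dense by blast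
  then show ?thesis by (rule is_hilbert_polynomialI[OF standard_graded_algebra_A])
qed

section \<open>Decomposing polynomials into sums of powers\<close>

lemma power_Suc_diff_ge:
  fixes x :: "'a::linordered_idom"
  assumes "x \<ge> 0"
  shows "x ^ Suc r + of_nat (Suc r) * x ^ r \<le> (x + 1) ^ Suc r"
proof (induction r)
  case (Suc r)
  have "x ^ Suc (Suc r) + of_nat (Suc (Suc r)) * x ^ Suc r
      \<le> (x + 1) * (x ^ Suc r + of_nat (Suc r) * x ^ r)"
    using assms by (simp add: algebra_simps)
  also have "\<dots> \<le> (x + 1) * (x + 1) ^ Suc r"
    using assms Suc by (intro mult_left_mono) auto
  finally show ?case by simp
qed simp

lemma sum_abs_power_le:
  assumes "n \<ge> 2" "r \<ge> 1"
  shows "int (Suc r) * (\<Sum>k<n. \<bar>1 - int k\<bar> ^ r) \<le> int n ^ Suc r"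
  using assms(1)
proof (induction n rule: dec_induct)
  \<comment> \<open>The sum equals 1, as \<open>k = 1\<close> contributes nothing when
    \<open>r \<ge> 1\<close>. The induction cannot start at \<open>n = 1\<close>, where the term for
    \<open>k = 0\<close> already violates the bound.\<close>
  case base
  have "int (Suc r) \<le> 2 ^ Suc r" using of_nat_less_two_power[of "Suc r", where ?'a = int] by simp
  then show ?case using assms(2) by (simp add: numeral_2_eq_2 zero_power)
next
  case (step n)
  have "\<bar>1 - int n\<bar> ^ r \<le> int n ^ r" using step by (intro power_mono) auto
  then have "int (Suc r) * \<bar>1 - int n\<bar> ^ r \<le> int (Suc r) * int n ^ r"
    by (intro mult_left_mono) auto
  then have "int (Suc r) * (\<Sum>k<Suc n. \<bar>1 - int k\<bar> ^ r)
      \<le> int n ^ Suc r + int (Suc r) * int n ^ r"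
    using step.IH by (simp add: algebra_simps)
  also have "\<dots> \<le> int (Suc n) ^ Suc r"
    using power_Suc_diff_ge[of "int n" r] by (simp add: add.commute)
  finally show ?case .
qed

lemma sum_diff_1: "2 * (\<Sum>k<n. 1 - int k) = int n * (3 - int n)"
  by (induction n) (auto simp: algebra_simps)

text \<open>The bracket combines the old coefficient bound with the bound on the power sum; the
  right-hand side is the bound for the new leading coefficient \<open>n'\<close>. The factor
  \<open>d / r\<close> is the ratio of the two binomial coefficients involved.\<close>

lemma growth_estimate:
  fixes n n' d :: real
  assumes "r \<ge> 2" "d > 0" "n > 0" "d * n \<ge> 26" "n' \<ge> d * n\<^sup>2 / 4"
  shows "d / r * (1 / 2 ^ (r + 2) + 1 / real (r + 1)) * n ^ (r + 1) \<le> n' ^ r / 2 ^ (r + 1)"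
proof -
  obtain s where s: "r = s + 2" using assms(1) by (metis add.commute le_Suc_ex)
  \<comment> \<open>The bracketed factor is largest at \<open>r = 2\<close>, where it is 19/96, just
    below (13/4)/16. The hypothesis \<open>d * n \<ge> 26\<close> enters through 26/8 =
    13/4.\<close>
  have "1 / real r * (1 / 2 ^ (r + 2) + 1 / real (r + 1)) \<le> 1 / 2 * (1 / 2 ^ 4 + 1 / 3)"
    unfolding s by (intro mult_mono add_mono frac_le power_increasing) auto
  also have "\<dots> \<le> (13 / 4) ^ 1 / 16" by simp
  also have "\<dots> \<le> (13 / 4) ^ Suc s / (16::real)"
    by (intro divide_right_mono power_increasing) auto
  finally have 1: "1 / real r * (1 / 2 ^ (r + 2) + 1 / real (r + 1)) \<le> (13 / 4) ^ Suc s / 16" .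
  have "d / r * (1 / 2 ^ (r + 2) + 1 / real (r + 1)) * n ^ (r + 1)
      = (1 / real r * (1 / 2 ^ (r + 2) + 1 / real (r + 1))) * (d * n ^ (r + 1))" by simp
  also have "\<dots> \<le> (13 / 4) ^ Suc s / 16 * (d * n ^ (r + 1))"
    using assms by (intro mult_right_mono 1) auto
  also have "\<dots> = 26 ^ Suc s * (d * n ^ (r + 1)) / (2 ^ (r + 1) * 4 ^ r)"
  proof -
    have "(26::real) ^ Suc s = (13 / 4) ^ Suc s * 8 ^ Suc s"
      by (subst power_mult_distrib[symmetric]) simp
    moreover have "(8::real) ^ Suc s * 16 = 2 ^ (r + 1) * 4 ^ r"
    proof -
      have "(8::real) ^ s = 2 ^ s * 4 ^ s" by (subst power_mult_distrib[symmetric]) simp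
      then show ?thesis by (simp add: s)
    qed
    ultimately show ?thesis by (simp add: field_simps)
  qed
  also have "\<dots> \<le> (d * n) ^ Suc s * (d * n ^ (r + 1)) / (2 ^ (r + 1) * 4 ^ r)"
    using assms by (intro divide_right_mono mult_right_mono power_mono) auto
  also have "\<dots> = (d * n\<^sup>2 / 4) ^ r / 2 ^ (r + 1)"
    by (simp add: s power_mult_distrib power_divide power_mult[symmetric] power_add power2_eq_square
        mult_2_right field_simps)
  also have "\<dots> \<le> n' ^ r / 2 ^ (r + 1)"
    using assms by (intro divide_right_mono power_mono) auto
  finally show ?thesis .
qed

text \<open>
  Subtracting \<open>\<Sum>k<n. (x + 1 - k) ^ d\<close>, where \<open>n\<close> is the leading coefficient, raises the coefficient
  at \<open>x ^ (d - 1)\<close> by \<open>d * n * (n - 3) / 2\<close>. The lower bounds on the other coefficients are chosen so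
  that they are inherited by the difference.
\<close>

lemma power_sums_decomposition:
  fixes a :: "nat \<Rightarrow> int"
  assumes "a d \<ge> 8" and "d \<ge> 2 \<Longrightarrow> a d \<ge> 13"
    and "\<And>i. i < d \<Longrightarrow>
      - (real (d choose i) * real_of_int (a d) ^ (d - i + 1) / 2 ^ (d - i + 2)) \<le> real_of_int (a i)"
  shows "\<exists>m :: nat \<Rightarrow> nat. \<forall>x. (\<Sum>i\<le>d. a i * x ^ i) = (\<Sum>j\<le>d. \<Sum>k<m j. (x + 1 - int k) ^ j)"
  using assms
proof (induction d arbitrary: a)
  case 0
  then show ?case by (intro exI[of _ "\<lambda>_. nat (a 0)"]) simp
next
  case (Suc d)
  let ?D = "Suc d"
  define n where "n = nat (a ?D)"
  have n: "a ?D = int n" "n \<ge> 8" "?D \<ge> 2 \<Longrightarrow> n \<ge> 13" using Suc.prems(1,2) by (auto simp: n_def)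
  define b where "b i = a i - int (?D choose i) * (\<Sum>k<n. (1 - int k) ^ (?D - i))" for i
  have expand: "(\<Sum>i\<le>?D. a i * x ^ i) = (\<Sum>i\<le>d. b i * x ^ i) + (\<Sum>k<n. (x + 1 - int k) ^ ?D)" for x
  proof -
    have "(\<Sum>k<n. (x + 1 - int k) ^ ?D)
        = (\<Sum>k<n. \<Sum>i\<le>?D. int (?D choose i) * x ^ i * (1 - int k) ^ (?D - i))"
      using binomial_ring[of x "1 - int k" ?D for k] by (simp add: algebra_simps)
    also have "\<dots> = (\<Sum>i\<le>?D. int (?D choose i) * (\<Sum>k<n. (1 - int k) ^ (?D - i)) * x ^ i)"
      by (subst sum.swap) (simp add: sum_distrib_left sum_distrib_right mult_ac)
    finally show ?thesis
      by (simp add: n(1) b_def algebra_simps sum_subtractf sum.distrib)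
  qed
  have lower: "- (real (?D choose i) * real n ^ (?D - i + 1) / 2 ^ (?D - i + 2)) \<le> real_of_int (a i)"
    if "i < ?D" for i
    using Suc.prems(3)[OF that] n(1) by simp
  \<comment> \<open>The gain \<open>?D * n * (n - 3) / 2\<close> is diminished by at most
    \<open>?D * n\<^sup>2 / 8\<close>, the lower bound on \<open>a d\<close>.\<close>
  have bd: "real_of_int (b d) \<ge> real ?D * (3 / 8 * (real n)\<^sup>2 - 3 / 2 * real n)"
  proof -
    have "real_of_int (2 * (\<Sum>k<n. 1 - int k)) = real n * (3 - real n)"
      by (subst sum_diff_1) simp
    then have "real_of_int (\<Sum>k<n. 1 - int k) = real n * (3 - real n) / 2"
      by (simp add: field_simps)
    then have "real_of_int (b d) = real_of_int (a d) - real ?D * (real n * (3 - real n) / 2)"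
      unfolding b_def by (simp add: Suc_diff_le)
    then show ?thesis using lower[of d]
      by (simp add: Suc_diff_le numeral_eq_Suc field_simps)
  qed
  have bd8: "b d \<ge> 8"
  proof -
    \<comment> \<open>This is the value of the bound at \<open>?D = 1\<close> and
      \<open>n = 8\<close>, the smallest admissible case.\<close>
    have "12 = 1 * (3 / 8 * 8 * (8 - 4 :: real))" by simp
    also have "\<dots> \<le> real ?D * (3 / 8 * real n * (real n - 4))"
      using n(2) by (intro mult_mono) auto
    also have "3 / 8 * real n * (real n - 4) = 3 / 8 * (real n)\<^sup>2 - 3 / 2 * real n"
      by (simp add: power2_eq_square right_diff_distrib)
    also note bd
    finally show ?thesis by simp
  qed
  have bdn: "real_of_int (b d) \<ge> real ?D * (real n)\<^sup>2 / 4" if "?D \<ge> 2"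
  proof -
    \<comment> \<open>From \<open>n = 12\<close> on, the linear term costs at most a third of the
      quadratic one, leaving the quarter that \<open>growth_estimate\<close> asks for.\<close>
    have "3 / 2 * real n \<le> 1 / 8 * (real n)\<^sup>2"
      using n(3)[OF that] by (simp add: power2_eq_square)
    then have "real ?D * ((real n)\<^sup>2 / 4) \<le> real ?D * (3 / 8 * (real n)\<^sup>2 - 3 / 2 * real n)"
      by (intro mult_left_mono) auto
    also note bd
    finally show ?thesis by simp
  qed
  have "\<exists>m :: nat \<Rightarrow> nat. \<forall>x. (\<Sum>i\<le>d. b i * x ^ i) = (\<Sum>j\<le>d. \<Sum>k<m j. (x + 1 - int k) ^ j)"
  proof (rule Suc.IH[of b, OF bd8])
    show "b d \<ge> 13" if "d \<ge> 2"
    proof -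
      have "1 * 13\<^sup>2 / 4 \<le> real ?D * (real n)\<^sup>2 / 4"
        using n(3) that by (intro divide_right_mono mult_mono power_mono) auto
      then show ?thesis using bdn that by simp
    qed
  next
    fix i assume i: "i < d"
    \<comment> \<open>Coefficients are indexed by their distance from the top. Here
      \<open>r \<ge> 2\<close>, since \<open>r = 1\<close> is the new leading coefficient treated
      above.\<close>
    define r where "r = ?D - i"
    have r: "r \<ge> 2" "d - i = r - 1" "?D - i = r" "i = ?D - r" "r \<le> ?D"
      using i by (auto simp: r_def)
    have choose: "real (?D choose i) = real ?D / real r * real (d choose i)"
    proof -
      have "r * (?D choose i) = ?D * (d choose i)"
        using binomial_absorb_comp[of ?D i] r by simp
      then have "real r * real (?D choose i) = real ?D * real (d choose i)"
        by (metis of_nat_mult)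
      then show ?thesis using r(1) by (simp add: field_simps)
    qed
    \<comment> \<open>This is the source of the threshold 13: the degree is at least 2 here, and 2 *
      13 = 26.\<close>
    have "real ?D * real n \<ge> 2 * 13" using n(3) i by (intro mult_mono) auto
    then have growth: "real ?D / r * (1 / 2 ^ (r + 2) + 1 / real (r + 1)) * real n ^ (r + 1)
        \<le> real_of_int (b d) ^ r / 2 ^ (r + 1)"
      using n bdn i r(1) by (intro growth_estimate) auto
    have "real (Suc r) * (\<Sum>k<n. \<bar>1 - real k\<bar> ^ r) \<le> real n ^ Suc r"
      using of_int_le_iff[where ?'a = real, THEN iffD2, OF sum_abs_power_le[of n r]] n(2) r(1) by simp
    then have S: "(\<Sum>k<n. \<bar>1 - real k\<bar> ^ r) \<le> real n ^ (r + 1) / real (r + 1)"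
      by (simp add: field_simps)
    have "real_of_int (\<Sum>k<n. (1 - int k) ^ r) \<le> (\<Sum>k<n. \<bar>1 - real k\<bar> ^ r)"
      by (simp, intro sum_mono, metis abs_ge_self power_abs)
    also note S
    finally have S': "real_of_int (\<Sum>k<n. (1 - int k) ^ r) \<le> real n ^ (r + 1) / real (r + 1)" .
    have "real (d choose i) * real_of_int (b d) ^ r / 2 ^ (r + 1)
        \<ge> real (d choose i) * (real ?D / r * (1 / 2 ^ (r + 2) + 1 / real (r + 1)) * real n ^ (r + 1))"
      using mult_left_mono[OF growth, of "real (d choose i)"] by simp
    \<comment> \<open>After the absorption identity, the new bound pays for both the possible
      negativity of \<open>a i\<close> and the power sum subtracted in \<open>b i\<close>.\<close>
    then have "real (d choose i) * real_of_int (b d) ^ r / 2 ^ (r + 1)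
        \<ge> real (?D choose i) * (real n ^ (r + 1) / 2 ^ (r + 2) + real n ^ (r + 1) / real (r + 1))"
      unfolding choose by (simp add: algebra_simps)
    moreover have "real (?D choose i) * real_of_int (\<Sum>k<n. (1 - int k) ^ r)
        \<le> real (?D choose i) * (real n ^ (r + 1) / real (r + 1))"
      by (intro mult_left_mono S') auto
    ultimately have "- (real (d choose i) * real_of_int (b d) ^ r / 2 ^ (r + 1)) \<le> real_of_int (b i)"
      using lower[of i] i by (simp add: b_def r(3) distrib_left)
    then show "- (real (d choose i) * real_of_int (b d) ^ (d - i + 1) / 2 ^ (d - i + 2))
        \<le> real_of_int (b i)"
      using r(1,2) by (simp add: numeral_eq_Suc)
  qed
  then obtain m :: "nat \<Rightarrow> nat"
    where m: "\<And>x. (\<Sum>i\<le>d. b i * x ^ i) = (\<Sum>j\<le>d. \<Sum>k<m j. (x + 1 - int k) ^ j)" by blast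
  have "(\<Sum>i\<le>?D. a i * x ^ i) = (\<Sum>j\<le>?D. \<Sum>k<(m(?D := n)) j. (x + 1 - int k) ^ j)" for x
    unfolding expand m by simp
  then show ?case by blast
qed

text \<open>The bound \<open>5 * d + 3\<close> is 8 for \<open>d = 1\<close> and at least 13 from
  \<open>d = 2\<close> on, the two thresholds of \<open>power_sums_decomposition\<close>. Once
  \<open>n \<ge> 8\<close>, the lower bounds required there on the other coefficients follow from
  \<open>- n \<le> a i\<close>.\<close>

lemma is_hilbert_polynomial_large_lead_coeff:
  fixes K :: "('a, 'm) ring_scheme" and a :: "nat \<Rightarrow> int" and n :: int
  assumes "field K" and "d > 0" and n: "n \<ge> 5 * int d + 3" and a: "\<And>i. i < d \<Longrightarrow> - n \<le> a i"
  shows "is_hilbert_polynomial K (monom (of_int n) d + (\<Sum>i<d. monom (of_int (a i)) i))"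
proof -
  define b where "b = a(d := n)"
  have "\<exists>m :: nat \<Rightarrow> nat. \<forall>x. (\<Sum>i\<le>d. b i * x ^ i) = (\<Sum>j\<le>d. \<Sum>k<m j. (x + 1 - int k) ^ j)"
  proof (rule power_sums_decomposition)
    show "b d \<ge> 8" using n \<open>d > 0\<close> by (simp add: b_def)
    show "b d \<ge> 13" if "d \<ge> 2" using n that by (simp add: b_def)
    fix i assume i: "i < d"
    obtain s where s: "d - i = Suc s" using i by (metis Suc_diff_Suc)
    have n8: "real_of_int n \<ge> 8" using n \<open>d > 0\<close> by linarith
    \<comment> \<open>\<open>X\<close> is \<open>n / 4\<close> times
      \<open>(n / 2) ^ (d - i)\<close>. As \<open>n / 2 \<ge> 4\<close> and the exponent is
      positive, \<open>X\<close> is at least \<open>n\<close>.\<close>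
    define X where "X = real_of_int n ^ (d - i + 1) / 2 ^ (d - i + 2)"
    have "real_of_int n * (4 * 4 ^ 0) \<le> real_of_int n * (4 * 4 ^ s)"
      using n8 by (intro mult_left_mono power_increasing) auto
    also have "\<dots> \<le> real_of_int n * ((real_of_int n / 2) * (real_of_int n / 2) ^ s)"
      using n8 by (intro mult_left_mono mult_mono power_mono) auto
    also have "\<dots> = 4 * X" by (simp add: X_def s power_divide)
    finally have "real_of_int n \<le> 1 * X" by simp
    also have "\<dots> \<le> real (d choose i) * X"
    proof (rule mult_right_mono)
      have "0 < d choose i" using i by (simp add: zero_less_binomial)
      then show "1 \<le> real (d choose i)" by linarith
    qed (use n8 in \<open>simp add: X_def\<close>)
    finally show "- (real (d choose i) * real_of_int (b d) ^ (d - i + 1) / 2 ^ (d - i + 2)) \<le> real_of_int (b i)"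
      using a[OF i] i by (simp add: b_def X_def)
  qed
  then obtain m :: "nat \<Rightarrow> nat"
    where m: "\<And>x. (\<Sum>i\<le>d. b i * x ^ i) = (\<Sum>j\<le>d. \<Sum>k<m j. (x + 1 - int k) ^ j)" by blast
  show ?thesis
  proof (rule is_hilbert_polynomial_power_sums[OF \<open>field K\<close>])
    fix x :: int
    have "(\<Sum>i\<le>d. b i * x ^ i) = n * x ^ d + (\<Sum>i<d. a i * x ^ i)"
      by (simp add: b_def flip: lessThan_Suc_atMost)
    then show "poly (monom (of_int n) d + (\<Sum>i<d. monom (of_int (a i)) i)) (of_int x)
        = (of_int (\<Sum>j\<le>d. \<Sum>k<m j. (x + 1 - int k) ^ j) :: rat)"
      unfolding m[symmetric] by (simp add: poly_monom poly_sum)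
  qed
qed

theorem theorem1:
  fixes K :: "('a, 'm) ring_scheme" and d :: nat and a :: "nat \<Rightarrow> int" and N :: int
  assumes "field K"
    and "d > 0"
    and "N = Min (a ` {..<d})"
  shows "(N \<ge> -2 \<longrightarrow>
            (\<forall>n::int. n \<ge> 5 * int d + 3 \<longrightarrow>
               is_hilbert_polynomial K
                 (monom (of_int n) d + (\<Sum>i<d. monom (of_int (a i)) i)))) \<and>
         (N < -2 \<longrightarrow>
            (\<forall>n::int. n \<ge> - 10 * int d * \<lfloor>rat_of_int N / 5\<rfloor> + 3 \<longrightarrow>
               is_hilbert_polynomial K
                 (monom (of_int n) d + (\<Sum>i<d. monom (of_int (a i)) i))))"
proof -
  have N: "N \<le> a i" if "i < d" for i using assms(3) that by simp
  show ?thesis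
  proof (intro conjI impI allI)
    fix n :: int assume n: "N \<ge> -2" "n \<ge> 5 * int d + 3"
    show "is_hilbert_polynomial K (monom (of_int n) d + (\<Sum>i<d. monom (of_int (a i)) i))"
    proof (rule is_hilbert_polynomial_large_lead_coeff[OF assms(1,2) n(2)])
      show "- n \<le> a i" if "i < d" for i using n N[OF that] by linarith
    qed
  next
    fix n :: int assume n: "N < -2" "n \<ge> - 10 * int d * \<lfloor>rat_of_int N / 5\<rfloor> + 3"
    define q where "q = - \<lfloor>rat_of_int N / 5\<rfloor>"
    \<comment> \<open>Rounding down gives \<open>- 5 * q \<le> N\<close>. Since \<open>d\<close> and
      \<open>q\<close> are at least 1, \<open>10 * d * q + 3\<close> exceeds both
      \<open>5 * q\<close> and the threshold \<open>5 * d + 3\<close>.\<close>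
    have q: "q \<ge> 1" "- (5 * q) \<le> N" unfolding q_def using n(1) by linarith+
    have "int d * 1 \<le> int d * q" "1 * q \<le> int d * q"
      using q assms(2) by (intro mult_left_mono mult_right_mono; simp)+
    moreover have "10 * (int d * q) + 3 \<le> n" using n(2) by (simp add: q_def)
    ultimately have n': "5 * int d + 3 \<le> n" "5 * q \<le> n" using q(1) by linarith+
    show "is_hilbert_polynomial K (monom (of_int n) d + (\<Sum>i<d. monom (of_int (a i)) i))"
    proof (rule is_hilbert_polynomial_large_lead_coeff[OF assms(1,2) n'(1)])
      show "- n \<le> a i" if "i < d" for i using n' q N[OF that] by linarith
    qed
  qed
qed

end
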